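(* Let $Z$ be a scalar instrumental variable, $U$ a scalar unmeasured confounder, $A\in\{0,1\}$ a treatment and $Y$ a real-valued outcome with potential outcomes $Y(1),Y(0)$, following the causal diagram $Z\to A$, $U\to A$, $U\to Y$, $A\to Y$ described in the context. Suppose that (a') $\mathrm{pr}(A=1\mid Z=z,U=u)=\beta(z)\gamma(u)$; (b) $\beta(z)$ is non-decreasing in $z$, $\gamma(u)$ is non-decreasing in $u$, and $E(Y\mid A=a,U=u)$ is non-decreasing in $u$ for both $a=1$ and $a=0$; (c) the essential supremum of $U$ given $(A=a,Z=z)$ depends only on $a$. Then $$\mathrm{ACE}_1^{\mathrm{adj}}\ge \mathrm{ACE}^{\mathrm{unadj}}\ge \mathrm{ACE}_1^{\mathrm{true}},\qquad \mathrm{ACE}_0^{\mathrm{adj}}\ge \mathrm{ACE}^{\mathrm{unadj}}\ge \mathrm{ACE}_0^{\mathrm{true}},\qquad \mathrm{ACE}^{\mathrm{adj}}\ge \mathrm{ACE}^{\mathrm{unadj}}\ge \mathrm{ACE}^{\mathrm{true}}.$$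
   Context: Setting. $A\in\{0,1\}$ is a binary treatment, $Z$ and $U$ are real-valued random variables, $Y(1),Y(0)$ are real-valued potential outcomes, and $Y=AY(1)+(1-A)Y(0)$. (Everything is conditional on observed covariates, which are suppressed.) The causal diagram is the directed acyclic graph with arrows $Z\to A$, $U\to A$, $U\to Y$, $A\to Y$ and means: $Z$ is independent of $U$; $Z$ is conditionally independent of $Y$ given $(A,U)$; $Z$ and $A$ are not independent; and $A$ is conditionally independent of $Y(a)$ given $U$ for $a=0,1$. True average causal effects: $\mathrm{ACE}_1^{\mathrm{true}}=E\{Y(1)\mid A=1\}-E\{Y(0)\mid A=1\}$, $\mathrm{ACE}_0^{\mathrm{true}}=E\{Y(1)\mid A=0\}-E\{Y(0)\mid A=0\}$, $\mathrm{ACE}^{\mathrm{true}}=E\{Y(1)\}-E\{Y(0)\}$. Unadjusted estimator: $\mathrm{ACE}^{\mathrm{unadj}}=E(Y\mid A=1)-E(Y\mid A=0)$. Adjusted estimators, with $\mu_a(z)=E(Y\mid A=a,Z=z)$ and $F$ denoting distributions: $\mathrm{ACE}_1^{\mathrm{adj}}=E(Y\mid A=1)-\int\mu_0(z)\,F(dz\mid A=1)$, $\mathrm{ACE}_0^{\mathrm{adj}}=\int\mu_1(z)\,F(dz\mid A=0)-E(Y\mid A=0)$, $\mathrm{ACE}^{\mathrm{adj}}=\int\mu_1(z)\,F(dz)-\int\mu_0(z)\,F(dz)$. All expectations and conditional quantities appearing are understood to be well defined. The essential supremum of $U$ given $(A=a,Z=z)$ is that of the conditional distribution of $U$ given $A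=a,Z=z$.
   Formalization: The factors β(z) and γ(u) are assumed nonnegative almost surely (with both negative the claim fails); "well defined" is read as pr(A=a|U)>0 and pr(A=a|Z)>0 almost surely, Y(a) integrable, and μ_a(Z) integrable. *)

theory Defs
  imports "HOL-Probability.Probability"
begin

(* E(X | W), for W taking values in the measurable space S, as a random variable on M. *)
definition cond_exp_given ::
    "'a measure \<Rightarrow> ('a \<Rightarrow> real) \<Rightarrow> ('a \<Rightarrow> 'w) \<Rightarrow> 'w measure \<Rightarrow> 'a \<Rightarrow> real" where
  "cond_exp_given M X W S = real_cond_exp M (vimage_algebra (space M) W S) X"

definition cond_prob_given ::
    "'a measure \<Rightarrow> 'a set \<Rightarrow> ('a \<Rightarrow> 'w) \<Rightarrow> 'w measure \<Rightarrow> 'a \<Rightarrow> real" where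
  "cond_prob_given M E W S = cond_exp_given M (indicator E) W S"

(* g is a version of the regression function w |-> E(X | W = w). *)
definition is_regression ::
    "'a measure \<Rightarrow> ('a \<Rightarrow> real) \<Rightarrow> ('a \<Rightarrow> 'w) \<Rightarrow> 'w measure \<Rightarrow> ('w \<Rightarrow> real) \<Rightarrow> bool" where
  "is_regression M X W S g \<longleftrightarrow>
     g \<in> borel_measurable S \<and> (AE \<omega> in M. cond_exp_given M X W S \<omega> = g (W \<omega>))"

(* K is a regular conditional distribution of the real variable X given W. *)
definition is_cond_distr ::
    "'a measure \<Rightarrow> ('a \<Rightarrow> real) \<Rightarrow> ('a \<Rightarrow> 'w) \<Rightarrow> 'w measure \<Rightarrow> ('w \<Rightarrow> real measure) \<Rightarrow> bool" where
  "is_cond_distr M X W S K \<longleftrightarrow>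
     K \<in> S \<rightarrow>\<^sub>M prob_algebra borel \<and>
     (\<forall>B \<in> sets borel.
        is_regression M (indicator {\<omega> \<in> space M. X \<omega> \<in> B}) W S (\<lambda>w. measure (K w) B))"

definition cond_indep ::
    "'a measure \<Rightarrow> 'b measure \<Rightarrow> ('a \<Rightarrow> 'b) \<Rightarrow> 'c measure \<Rightarrow> ('a \<Rightarrow> 'c)
      \<Rightarrow> 'w measure \<Rightarrow> ('a \<Rightarrow> 'w) \<Rightarrow> bool" where
  "cond_indep M SX X SY Y S W \<longleftrightarrow>
     X \<in> M \<rightarrow>\<^sub>M SX \<and> Y \<in> M \<rightarrow>\<^sub>M SY \<and> W \<in> M \<rightarrow>\<^sub>M S \<and>
     (\<forall>B \<in> sets SX. \<forall>C \<in> sets SY. AE \<omega> in M.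
        cond_prob_given M {\<omega> \<in> space M. X \<omega> \<in> B \<and> Y \<omega> \<in> C} W S \<omega> =
        cond_prob_given M {\<omega> \<in> space M. X \<omega> \<in> B} W S \<omega> *
        cond_prob_given M {\<omega> \<in> space M. Y \<omega> \<in> C} W S \<omega>)"

(* f is non-decreasing on a set carrying all the mass of D.  Regression functions are only
   determined up to null sets, and a real-valued function that is unbounded on the range of
   the conditioning variable need not extend to a monotone real function on the whole line. *)
definition ae_nondecreasing :: "real measure \<Rightarrow> (real \<Rightarrow> real) \<Rightarrow> bool" where
  "ae_nondecreasing D f \<longleftrightarrow> (\<exists>S. (AE x in D. x \<in> S) \<and> mono_on S f)"

(* The treatment A has values in {0,1}; the notions below condition on the event A = a, which
   uniform_measure does in the elementary way: mean_arm is E(X | A = a), distr_arm is F(dz | A = a). *)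

definition arm :: "'a measure \<Rightarrow> ('a \<Rightarrow> nat) \<Rightarrow> nat \<Rightarrow> 'a set" where
  "arm M A a = {\<omega> \<in> space M. A \<omega> = a}"

definition mean_arm :: "'a measure \<Rightarrow> ('a \<Rightarrow> nat) \<Rightarrow> nat \<Rightarrow> ('a \<Rightarrow> real) \<Rightarrow> real" where
  "mean_arm M A a X = (\<integral>\<omega>. X \<omega> \<partial>uniform_measure M (arm M A a))"

definition distr_arm :: "'a measure \<Rightarrow> ('a \<Rightarrow> nat) \<Rightarrow> nat \<Rightarrow> ('a \<Rightarrow> real) \<Rightarrow> real measure" where
  "distr_arm M A a Z = distr (uniform_measure M (arm M A a)) borel Z"

(* Yp a is the potential outcome Y(a). *)

definition ACE_true_arm ::
    "'a measure \<Rightarrow> ('a \<Rightarrow> nat) \<Rightarrow> (nat \<Rightarrow> 'a \<Rightarrow> real) \<Rightarrow> nat \<Rightarrow> real" where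
  "ACE_true_arm M A Yp a = mean_arm M A a (Yp 1) - mean_arm M A a (Yp 0)"

definition ACE_true :: "'a measure \<Rightarrow> (nat \<Rightarrow> 'a \<Rightarrow> real) \<Rightarrow> real" where
  "ACE_true M Yp = (\<integral>\<omega>. Yp 1 \<omega> \<partial>M) - (\<integral>\<omega>. Yp 0 \<omega> \<partial>M)"

definition ACE_unadj :: "'a measure \<Rightarrow> ('a \<Rightarrow> nat) \<Rightarrow> ('a \<Rightarrow> real) \<Rightarrow> real" where
  "ACE_unadj M A Y = mean_arm M A 1 Y - mean_arm M A 0 Y"

(* In the adjusted estimators, \<mu> a z stands for E(Y | A = a, Z = z). *)

definition ACE1_adj ::
    "'a measure \<Rightarrow> ('a \<Rightarrow> nat) \<Rightarrow> ('a \<Rightarrow> real) \<Rightarrow> ('a \<Rightarrow> real) \<Rightarrow> (nat \<Rightarrow> real \<Rightarrow> real) \<Rightarrow> real" where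
  "ACE1_adj M A Z Y \<mu> = mean_arm M A 1 Y - (\<integral>z. \<mu> 0 z \<partial>distr_arm M A 1 Z)"

definition ACE0_adj ::
    "'a measure \<Rightarrow> ('a \<Rightarrow> nat) \<Rightarrow> ('a \<Rightarrow> real) \<Rightarrow> ('a \<Rightarrow> real) \<Rightarrow> (nat \<Rightarrow> real \<Rightarrow> real) \<Rightarrow> real" where
  "ACE0_adj M A Z Y \<mu> = (\<integral>z. \<mu> 1 z \<partial>distr_arm M A 0 Z) - mean_arm M A 0 Y"

definition ACE_adj :: "'a measure \<Rightarrow> ('a \<Rightarrow> real) \<Rightarrow> (nat \<Rightarrow> real \<Rightarrow> real) \<Rightarrow> real" where
  "ACE_adj M Z \<mu> = (\<integral>z. \<mu> 1 z \<partial>distr M borel Z) - (\<integral>z. \<mu> 0 z \<partial>distr M borel Z)"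

end

theory Submission
  imports Defs
begin

text \<open>Write \<open>g = E \<gamma>(U)\<close> and \<open>b = E \<beta>(Z)\<close>. Independence of \<open>Z\<close> and \<open>U\<close> and the product form of
  the propensity give \<open>E(Y | A = 1, Z = z) = E(m\<^sub>1(U) \<gamma>(U)) / g\<close>, which does not depend on \<open>z\<close>, and
  \<open>E(Y | A = 0, Z = z) = (E m\<^sub>0(U) - \<beta>(z) E(m\<^sub>0(U) \<gamma>(U))) / (1 - \<beta>(z) g)\<close>. The latter is a
  non-increasing function of \<open>\<beta>(z)\<close> exactly because \<open>cov(m\<^sub>0(U), \<gamma>(U)) \<ge> 0\<close>, so its covariance with
  \<open>\<beta>(Z)\<close> is non-positive, and all inequalities between the adjusted and the unadjusted estimators
  follow. Those between the unadjusted estimator and the true effects are the inequalities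
  \<open>cov(m\<^sub>a(U), \<gamma>(U)) \<ge> 0\<close>, since \<open>E(Y(a) | A = 1)\<close> and \<open>E(Y(a) | A = 0)\<close> average \<open>m\<^sub>a(U)\<close> with weights
  \<open>\<gamma>(U) / g\<close> and \<open>(1 - b \<gamma>(U)) / (1 - b g)\<close>. Both covariance signs are instances of Chebyshev's
  association inequality.\<close>

section \<open>Association inequality and products of independent variables\<close>

text \<open>Chebyshev's association inequality: integrate \<open>(f x - f y) * (g x - g y)\<close>
  over \<open>y\<close> with \<open>x\<close> fixed, then over \<open>x\<close>; iterating single
  integrals avoids the product space. Comonotonicity is asked for pairs of sample points in a set of
  full mass, because the functions it is applied to are controlled only almost everywhere.\<close>

lemma (in prob_space) integral_mult_ge_if_comonotone:
  fixes f g :: "'a \<Rightarrow> real"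
  assumes int: "integrable M f" "integrable M g" "integrable M (\<lambda>x. f x * g x)"
    and S: "AE x in M. x \<in> S"
    and como: "\<And>x y. x \<in> S \<Longrightarrow> y \<in> S \<Longrightarrow> 0 \<le> (f x - f y) * (g x - g y)"
  shows "expectation f * expectation g \<le> expectation (\<lambda>x. f x * g x)"
proof -
  have inner: "0 \<le> f x * g x - f x * expectation g - expectation f * g x + expectation (\<lambda>y. f y * g y)"
    if x: "x \<in> S" for x
  proof -
    have "0 \<le> (\<integral>y. (f x - f y) * (g x - g y) \<partial>M)"
      using S by (intro integral_nonneg_AE) (auto elim!: eventually_mono intro: como[OF x])
    also have "\<dots> = (\<integral>y. f x * g x - f x * g y - f y * g x + f y * g y \<partial>M)"
      by (simp add: algebra_simps)
    also have "\<dots> = f x * g x - f x * expectation g - expectation f * g x + expectation (\<lambda>y. f y * g y)"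
      using int by (simp add: prob_space)
    finally show ?thesis .
  qed
  have "0 \<le> (\<integral>x. f x * g x - f x * expectation g - expectation f * g x
      + expectation (\<lambda>y. f y * g y) \<partial>M)"
    using S by (intro integral_nonneg_AE) (auto elim!: eventually_mono intro: inner)
  also have "\<dots> = 2 * (expectation (\<lambda>x. f x * g x) - expectation f * expectation g)"
    using int by (simp add: prob_space)
  finally show ?thesis by simp
qed

text \<open>By Fubini, \<open>x * Y\<close> is integrable for almost every value \<open>x\<close> of
  \<open>X\<close>; if \<open>X\<close> is not almost surely zero, some such \<open>x\<close> is
  nonzero and can be divided out. This later separates functions of \<open>Z\<close> from functions
  of \<open>U\<close> when only their product is known to be integrable.\<close>

lemma (in prob_space) indep_var_integrable_factor:
  fixes X Y :: "'a \<Rightarrow> real"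
  assumes indep: "indep_var borel X borel Y"
    and int: "integrable M (\<lambda>\<omega>. X \<omega> * Y \<omega>)"
  shows "\<not> (AE \<omega> in M. Y \<omega> = 0) \<Longrightarrow> integrable M X"
    and "\<not> (AE \<omega> in M. X \<omega> = 0) \<Longrightarrow> integrable M Y"
proof -
  have [measurable]: "X \<in> borel_measurable M" "Y \<in> borel_measurable M"
    using indep indep_var_rv1 indep_var_rv2 by blast+
  interpret X: prob_space "distr M borel X" by (rule prob_space_distr) simp
  interpret Y: prob_space "distr M borel Y" by (rule prob_space_distr) simp
  interpret XY: pair_prob_space "distr M borel X" "distr M borel Y" ..
  have "integrable (distr M (borel \<Otimes>\<^sub>M borel) (\<lambda>\<omega>. (X \<omega>, Y \<omega>))) (\<lambda>(x, y). x * y)"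
    by (subst integrable_distr_eq) (simp_all add: int)
  then have XY: "integrable (distr M borel X \<Otimes>\<^sub>M distr M borel Y) (\<lambda>(x, y). x * y)"
    using indep by (simp add: indep_var_distribution_eq)
  show "integrable M Y" if nz: "\<not> (AE \<omega> in M. X \<omega> = 0)"
  proof -
    have ae: "AE \<omega> in M. integrable (distr M borel Y) (\<lambda>y. X \<omega> * y)"
      by (rule AE_distrD[OF _ XY.AE_integrable_fst[OF XY]]) simp
    obtain \<omega> where "X \<omega> \<noteq> 0" "integrable (distr M borel Y) (\<lambda>y. X \<omega> * y)"
      using nz eventually_mono[OF ae, of "\<lambda>\<omega>. X \<omega> = 0"] by blast
    then have "integrable (distr M borel Y) (\<lambda>y. y)" by simp
    then show ?thesis by (subst (asm) integrable_distr_eq) auto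
  qed
  show "integrable M X" if nz: "\<not> (AE \<omega> in M. Y \<omega> = 0)"
  proof -
    have ae: "AE \<omega> in M. integrable (distr M borel X) (\<lambda>x. x * Y \<omega>)"
      by (rule AE_distrD[OF _ XY.AE_integrable_snd[OF XY]]) simp
    obtain \<omega> where "Y \<omega> \<noteq> 0" "integrable (distr M borel X) (\<lambda>x. x * Y \<omega>)"
      using nz eventually_mono[OF ae, of "\<lambda>\<omega>. Y \<omega> = 0"] by blast
    then have "integrable (distr M borel X) (\<lambda>x. x)" by simp
    then show ?thesis by (subst (asm) integrable_distr_eq) auto
  qed
qed

section \<open>Conditional expectation given a random variable\<close>

lemma subalgebra_vimage_algebra:
  assumes "W \<in> M \<rightarrow>\<^sub>M S"
  shows "subalgebra M (vimage_algebra (space M) W S)"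
  unfolding subalgebra_def using sets_image_in_sets[OF refl assms] by simp

lemma sigma_finite_subalgebra_vimage_algebra:
  assumes "prob_space M" "W \<in> M \<rightarrow>\<^sub>M S"
  shows "sigma_finite_subalgebra M (vimage_algebra (space M) W S)"
proof -
  interpret prob_space M by fact
  show ?thesis
    by (intro finite_measure_subalgebra_is_sigma_finite finite_measure_subalgebra.intro
        finite_measure_subalgebra_axioms.intro finite_measure_axioms subalgebra_vimage_algebra assms)
qed

lemma measurable_vimage_algebra_compose:
  assumes "W \<in> M \<rightarrow>\<^sub>M S" "f \<in> S \<rightarrow>\<^sub>M T"
  shows "(\<lambda>\<omega>. f (W \<omega>)) \<in> vimage_algebra (space M) W S \<rightarrow>\<^sub>M T"
  using measurable_comp[OF measurable_vimage_algebra1 assms(2), of W "space M"] assms(1)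
  by (auto simp: comp_def dest: measurable_space)

text \<open>Turns the almost sure identity that defines a regression into an integral identity
  tested against functions of \<open>W\<close>, the form in which regressions are used
  below.\<close>

lemma regression_integral:
  fixes X :: "'a \<Rightarrow> real"
  assumes "prob_space M" and W[measurable]: "W \<in> M \<rightarrow>\<^sub>M S"
    and g: "is_regression M X W S g"
    and X[measurable]: "X \<in> borel_measurable M"
    and f[measurable]: "f \<in> borel_measurable S"
    and int: "integrable M (\<lambda>\<omega>. f (W \<omega>) * X \<omega>)"
  shows "integrable M (\<lambda>\<omega>. f (W \<omega>) * g (W \<omega>))"
    and "(\<integral>\<omega>. f (W \<omega>) * X \<omega> \<partial>M) = (\<integral>\<omega>. f (W \<omega>) * g (W \<omega>) \<partial>M)"
proof -
  interpret sigma_finite_subalgebra M "vimage_algebra (space M) W S"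
    by (rule sigma_finite_subalgebra_vimage_algebra) fact+
  have [measurable]: "g \<in> borel_measurable S" using g by (simp add: is_regression_def)
  have ae: "AE \<omega> in M. f (W \<omega>) * cond_exp_given M X W S \<omega> = f (W \<omega>) * g (W \<omega>)"
    using g by (auto simp: is_regression_def elim!: eventually_mono)
  have fm: "(\<lambda>\<omega>. f (W \<omega>)) \<in> borel_measurable (vimage_algebra (space M) W S)"
    by (rule measurable_vimage_algebra_compose) fact+
  note r = real_cond_exp_intg[OF int fm X, folded cond_exp_given_def]
  have [measurable]: "cond_exp_given M X W S \<in> borel_measurable M"
    unfolding cond_exp_given_def by simp
  show "integrable M (\<lambda>\<omega>. f (W \<omega>) * g (W \<omega>))"
    using r(1) integrable_cong_AE[OF _ _ ae] by simp
  show "(\<integral>\<omega>. f (W \<omega>) * X \<omega> \<partial>M) = (\<integral>\<omega>. f (W \<omega>) * g (W \<omega>) \<partial>M)"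
    using r(2) integral_cong_AE[OF _ _ ae] by simp
qed

text \<open>\<open>cond_indep\<close> speaks of events only; this carries it over to an integrable
  \<open>Y\<close>. Weighting \<open>M\<close> by the indicators of \<open>D\<close> and of the
  event that \<open>X\<close> lies in \<open>B\<close>, or by the indicator of \<open>D\<close>
  times the conditional probability of that event, gives \<open>Y\<close> the same image measure and
  hence the same integral.\<close>

lemma cond_indep_integral:
  fixes Y :: "'a \<Rightarrow> real"
  assumes prob: "prob_space M" and ci: "cond_indep M SX X borel Y S W"
    and Y: "integrable M Y" and B: "B \<in> sets SX" and D: "D \<in> sets (vimage_algebra (space M) W S)"
  shows "(\<integral>\<omega>. indicator D \<omega> * indicator B (X \<omega>) * Y \<omega> \<partial>M)
       = (\<integral>\<omega>. indicator D \<omega> * indicator B (X \<omega>) * cond_exp_given M Y W S \<omega> \<partial>M)"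
proof -
  interpret prob_space M by fact
  let ?F = "vimage_algebra (space M) W S"
  have XM[measurable]: "X \<in> M \<rightarrow>\<^sub>M SX" and YM[measurable]: "Y \<in> borel_measurable M"
    and W[measurable]: "W \<in> M \<rightarrow>\<^sub>M S" using ci by (auto simp: cond_indep_def)
  interpret sigma_finite_subalgebra M ?F
    by (rule sigma_finite_subalgebra_vimage_algebra) fact+
  note [measurable] = B
  have DM[measurable]: "D \<in> sets M" using D subalg by (auto simp: subalgebra_def)
  define EB where "EB = {\<omega> \<in> space M. X \<omega> \<in> B}"
  have [measurable]: "EB \<in> sets M" unfolding EB_def by measurable
  have ind: "indicator B (X \<omega>) = (indicator EB \<omega> :: real)" if "\<omega> \<in> space M" for \<omega>
    using that by (auto simp: EB_def indicator_def)
  \<comment> \<open>The conditional probability of \<open>EB\<close>, clipped to [0, 1] at every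
    point so that it can serve as a bounded density and its product with \<open>Y\<close> stays
    integrable.\<close>
  define q where "q = (\<lambda>\<omega>. min 1 (max 0 (cond_prob_given M EB W S \<omega>)))"
  have qF[measurable]: "q \<in> borel_measurable ?F"
    unfolding q_def cond_prob_given_def cond_exp_given_def by simp
  have [measurable]: "q \<in> borel_measurable M"
    by (rule measurable_from_subalg[OF subalg qF])
  have "AE \<omega> in M. 0 \<le> cond_prob_given M EB W S \<omega>"
    unfolding cond_prob_given_def cond_exp_given_def by (rule real_cond_exp_pos) auto
  moreover have "AE \<omega> in M. cond_prob_given M EB W S \<omega> \<le> 1"
    unfolding cond_prob_given_def cond_exp_given_def
    by (rule real_cond_exp_le_c) (auto simp: indicator_def less_top[symmetric])
  ultimately have q: "AE \<omega> in M. q \<omega> = cond_prob_given M EB W S \<omega>"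
    by eventually_elim (simp add: q_def)
  have q01: "0 \<le> q \<omega>" "q \<omega> \<le> 1" for \<omega> by (auto simp: q_def)
  have bint: "integrable M f" if "f \<in> borel_measurable M" "\<And>\<omega>. \<bar>f \<omega>\<bar> \<le> 1" for f :: "'a \<Rightarrow> real"
    using that by (intro integrable_const_bound[where B=1]) auto
  let ?u = "\<lambda>\<omega>. indicator D \<omega> * indicator EB \<omega> :: real"
  let ?v = "\<lambda>\<omega>. indicator D \<omega> * q \<omega>"
  have u01: "0 \<le> ?u \<omega>" "?u \<omega> \<le> 1" for \<omega> by (auto simp: indicator_def)
  have v01: "0 \<le> ?v \<omega>" "?v \<omega> \<le> 1" for \<omega> using q01 by (auto simp: indicator_def)
  \<comment> \<open>Equality of the two image measures only has to be checked on Borel sets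
    \<open>C\<close>, where conditional independence of events applies; the unbounded
    \<open>Y\<close> enters afterwards as the integral of the identity.\<close>
  have "distr (density M ?u) borel Y = distr (density M ?v) borel Y"
  proof (rule measure_eqI)
    fix C :: "real set" assume "C \<in> sets (distr (density M ?u) borel Y)"
    then have C[measurable]: "C \<in> sets borel" by simp
    define EC where "EC = {\<omega> \<in> space M. Y \<omega> \<in> C}"
    have [measurable]: "EC \<in> sets M" unfolding EC_def by measurable
    have EBC: "{\<omega> \<in> space M. X \<omega> \<in> B \<and> Y \<omega> \<in> C} = EB \<inter> EC" by (auto simp: EB_def EC_def)
    have ci': "AE \<omega> in M. cond_prob_given M (EB \<inter> EC) W S \<omega>
        = cond_prob_given M EB W S \<omega> * cond_prob_given M EC W S \<omega>"
      unfolding EBC[symmetric] unfolding EB_def EC_def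
      using ci B C unfolding cond_indep_def by blast
    have "(\<integral>\<omega>. ?u \<omega> * indicator EC \<omega> \<partial>M) = (\<integral>\<omega>. indicator D \<omega> * indicator (EB \<inter> EC) \<omega> \<partial>M)"
      by (simp add: indicator_inter_arith mult.assoc)
    also have "\<dots> = (\<integral>\<omega>. indicator D \<omega> * cond_prob_given M (EB \<inter> EC) W S \<omega> \<partial>M)"
      unfolding cond_prob_given_def cond_exp_given_def
      by (rule real_cond_exp_intg(2)[symmetric])
         (auto intro!: bint borel_measurable_indicator D split: split_indicator)
    also have "\<dots> = (\<integral>\<omega>. ?v \<omega> * cond_prob_given M EC W S \<omega> \<partial>M)"
    proof (rule integral_cong_AE)
      show "AE \<omega> in M. indicator D \<omega> * cond_prob_given M (EB \<inter> EC) W S \<omega>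
          = ?v \<omega> * cond_prob_given M EC W S \<omega>"
        using ci' q by eventually_elim simp
    qed (simp_all add: cond_prob_given_def cond_exp_given_def)
    also have "\<dots> = (\<integral>\<omega>. ?v \<omega> * indicator EC \<omega> \<partial>M)"
      unfolding cond_prob_given_def cond_exp_given_def
    proof (rule real_cond_exp_intg(2))
      show "integrable M (\<lambda>\<omega>. ?v \<omega> * indicator EC \<omega>)"
        using q01 by (intro bint) (auto split: split_indicator)
      show "?v \<in> borel_measurable ?F"
        using D qF by (intro borel_measurable_times borel_measurable_indicator) auto
    qed simp
    finally have eq: "(\<integral>\<omega>. ?u \<omega> * indicator EC \<omega> \<partial>M) = (\<integral>\<omega>. ?v \<omega> * indicator EC \<omega> \<partial>M)" .
    have em: "emeasure (distr (density M f) borel Y) C = ennreal (\<integral>\<omega>. f \<omega> * indicator EC \<omega> \<partial>M)"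
      if [measurable]: "f \<in> borel_measurable M" and f: "\<And>\<omega>. 0 \<le> f \<omega>" "\<And>\<omega>. f \<omega> \<le> 1" for f :: "'a \<Rightarrow> real"
    proof -
      have "emeasure (distr (density M f) borel Y) C = (\<integral>\<^sup>+\<omega>. ennreal (f \<omega>) * indicator EC \<omega> \<partial>M)"
        by (simp add: emeasure_distr emeasure_density EC_def vimage_def Int_def conj_commute)
      also have "\<dots> = (\<integral>\<^sup>+\<omega>. ennreal (f \<omega> * indicator EC \<omega>) \<partial>M)"
        by (intro nn_integral_cong) (auto split: split_indicator)
      also have "\<dots> = ennreal (\<integral>\<omega>. f \<omega> * indicator EC \<omega> \<partial>M)"
        using f by (intro nn_integral_eq_integral bint) (auto split: split_indicator)
      finally show ?thesis .
    qed
    show "emeasure (distr (density M ?u) borel Y) C = emeasure (distr (density M ?v) borel Y) C"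
      by (subst (1 2) em) (use u01 v01 eq in auto)
  qed simp
  then have "(\<integral>y. y \<partial>distr (density M ?u) borel Y) = (\<integral>y. y \<partial>distr (density M ?v) borel Y)"
    by simp
  then have "(\<integral>\<omega>. ?u \<omega> * Y \<omega> \<partial>M) = (\<integral>\<omega>. ?v \<omega> * Y \<omega> \<partial>M)"
    using u01 v01 by (simp add: integral_distr integral_density)
  also have "\<dots> = (\<integral>\<omega>. ?v \<omega> * cond_exp_given M Y W S \<omega> \<partial>M)"
    unfolding cond_exp_given_def
  proof (rule real_cond_exp_intg(2)[symmetric])
    show "integrable M (\<lambda>\<omega>. ?v \<omega> * Y \<omega>)"
      using q01 by (intro Bochner_Integration.integrable_bound[OF Y])
        (auto simp: abs_mult intro!: mult_left_le_one_le split: split_indicator)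
    show "?v \<in> borel_measurable ?F"
      using D qF by (intro borel_measurable_times borel_measurable_indicator) auto
  qed simp
  \<comment> \<open>With \<open>Y\<close> replaced by its conditional expectation, the other factor
    is measurable in the sub-algebra, so the averaging can be undone: \<open>q\<close> turns back
    into the indicator of \<open>EB\<close>.\<close>
  also have "\<dots> = (\<integral>\<omega>. (indicator D \<omega> * cond_exp_given M Y W S \<omega>) * cond_prob_given M EB W S \<omega> \<partial>M)"
  proof (rule integral_cong_AE)
    show "AE \<omega> in M. ?v \<omega> * cond_exp_given M Y W S \<omega>
        = (indicator D \<omega> * cond_exp_given M Y W S \<omega>) * cond_prob_given M EB W S \<omega>"
      using q by eventually_elim simp
  qed (simp_all add: cond_prob_given_def cond_exp_given_def)
  also have "\<dots> = (\<integral>\<omega>. (indicator D \<omega> * cond_exp_given M Y W S \<omega>) * indicator EB \<omega> \<partial>M)"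
    unfolding cond_prob_given_def cond_exp_given_def
  proof (rule real_cond_exp_intg(2))
    show "integrable M (\<lambda>\<omega>. (indicator D \<omega> * real_cond_exp M ?F Y \<omega>) * indicator EB \<omega>)"
      by (rule Bochner_Integration.integrable_bound[OF real_cond_exp_int(1)[OF Y]])
        (auto split: split_indicator)
    show "(\<lambda>\<omega>. indicator D \<omega> * real_cond_exp M ?F Y \<omega>) \<in> borel_measurable ?F"
      using D by (intro borel_measurable_times borel_measurable_indicator) auto
  qed simp
  finally have "(\<integral>\<omega>. ?u \<omega> * Y \<omega> \<partial>M) = (\<integral>\<omega>. ?u \<omega> * cond_exp_given M Y W S \<omega> \<partial>M)"
    by (simp add: mult_ac)
  then show ?thesis
    by (simp add: ind cong: Bochner_Integration.integral_cong)
qed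

text \<open>The hypothesis \<open>zero\<close> says that \<open>v * p\<close> has conditional
  expectation 0 given \<open>F\<close>; pulling out \<open>v\<close> leaves \<open>v\<close> times a
  positive function. It serves to identify two functions of \<open>U\<close> that are only compared
  on one arm.\<close>

lemma (in sigma_finite_subalgebra) AE_zero_if_weighted_integral_zero:
  assumes vF: "v \<in> borel_measurable F" and p: "p \<in> borel_measurable M"
    and int: "integrable M (\<lambda>x. v x * p x)"
    and zero: "\<And>D. D \<in> sets F \<Longrightarrow> (\<integral>x. indicator D x * (v x * p x) \<partial>M) = 0"
    and pos: "AE x in M. 0 < real_cond_exp M F p x"
  shows "AE x in M. v x = 0"
proof -
  have "AE x in M. real_cond_exp M F (\<lambda>x. v x * p x) x = 0"
    by (rule real_cond_exp_charact) (use int zero in \<open>auto simp: set_lebesgue_integral_def\<close>)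
  moreover have "AE x in M. real_cond_exp M F (\<lambda>x. v x * p x) x = v x * real_cond_exp M F p x"
    by (rule real_cond_exp_mult) fact+
  ultimately show ?thesis using pos by eventually_elim auto
qed

section \<open>Regressions on a treatment arm\<close>

lemma integral_uniform_measure:
  fixes f :: "'a \<Rightarrow> real"
  assumes "finite_measure M" "E \<in> sets M" "measure M E \<noteq> 0" "f \<in> borel_measurable M"
  shows "(\<integral>x. f x \<partial>uniform_measure M E) = (\<integral>x. f x * indicator E x \<partial>M) / measure M E"
proof -
  interpret finite_measure M by fact
  have "uniform_measure M E = density M (\<lambda>x. ennreal (indicator E x / measure M E))"
    using assms unfolding uniform_measure_def
    by (intro density_cong) (auto simp: emeasure_eq_measure divide_ennreal ennreal_indicator[symmetric] zero_less_measure_iff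
       simp del: ennreal_indicator)
  then show ?thesis using assms
    by (simp add: integral_density mult.commute)
qed

lemma indicator_arm_eq:
  "\<omega> \<in> space M \<Longrightarrow> indicator (arm M A a) \<omega> = indicator {a} (A \<omega>)"
  by (simp add: arm_def indicator_def)

lemma sets_arm:
  assumes "A \<in> M \<rightarrow>\<^sub>M count_space {0, 1}" "a \<in> {0, 1}"
  shows "arm M A a \<in> sets M"
proof -
  have "A -` {a} \<inter> space M \<in> sets M" using assms by (intro measurable_sets[OF assms(1)]) auto
  then show ?thesis by (simp add: arm_def vimage_def Int_def conj_commute)
qed

text \<open>Every event generated by \<open>W\<close> is a preimage under \<open>W\<close>, so
  indicators of \<open>B\<close> at \<open>W\<close> suffice as tests. Two functions of
  \<open>Z\<close> that pass this test for the same variable must agree almost surely.\<close>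

lemma cond_exp_given_eqI:
  assumes "prob_space M" and W[measurable]: "W \<in> M \<rightarrow>\<^sub>M S" and X: "integrable M X"
    and w[measurable]: "w \<in> borel_measurable S" and wint: "integrable M (\<lambda>\<omega>. w (W \<omega>))"
    and eq: "\<And>B. B \<in> sets S \<Longrightarrow>
      (\<integral>\<omega>. indicator B (W \<omega>) * X \<omega> \<partial>M) = (\<integral>\<omega>. indicator B (W \<omega>) * w (W \<omega>) \<partial>M)"
  shows "AE \<omega> in M. cond_exp_given M X W S \<omega> = w (W \<omega>)"
proof -
  interpret sigma_finite_subalgebra M "vimage_algebra (space M) W S"
    by (rule sigma_finite_subalgebra_vimage_algebra) fact+
  show ?thesis unfolding cond_exp_given_def
  proof (rule real_cond_exp_charact[OF _ X wint])
    fix D assume "D \<in> sets (vimage_algebra (space M) W S)"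
    then obtain B where B: "B \<in> sets S" "D = W -` B \<inter> space M"
      by (subst (asm) sets_vimage_algebra2) (auto simp: measurable_space[OF W])
    have "indicator D \<omega> = (indicator B (W \<omega>) :: real)" if "\<omega> \<in> space M" for \<omega>
      using that B by (simp add: indicator_def)
    with eq[OF B(1)] show "(LINT x:D|M. X x) = (LINT x:D|M. w (W x))"
      by (simp add: set_lebesgue_integral_def cong: Bochner_Integration.integral_cong)
  qed (rule measurable_vimage_algebra_compose; fact)
qed

text \<open>The regression on the pair is tested against the indicator of \<open>{a}\<close> times
  that of \<open>B\<close>, which isolates one arm. Integrability is claimed only together with the
  arm indicator, since the regression says nothing about \<open>r a\<close> off that arm.\<close>

lemma arm_regression:
  fixes A :: "'a \<Rightarrow> nat" and r :: "nat \<Rightarrow> real \<Rightarrow> real"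
  assumes "prob_space M" and A[measurable]: "A \<in> M \<rightarrow>\<^sub>M count_space {0, 1}"
    and V[measurable]: "V \<in> borel_measurable M" and Y: "integrable M Y"
    and r: "is_regression M Y (\<lambda>\<omega>. (A \<omega>, V \<omega>)) (count_space {0, 1} \<Otimes>\<^sub>M borel) (\<lambda>(a, v). r a v)"
    and a: "a \<in> {0, 1}"
  shows "r a \<in> borel_measurable borel"
    and "integrable M (\<lambda>\<omega>. indicator (arm M A a) \<omega> * r a (V \<omega>))"
    and "B \<in> sets borel \<Longrightarrow> (\<integral>\<omega>. indicator B (V \<omega>) * (indicator (arm M A a) \<omega> * Y \<omega>) \<partial>M)
      = (\<integral>\<omega>. indicator B (V \<omega>) * (indicator (arm M A a) \<omega> * r a (V \<omega>)) \<partial>M)"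
proof -
  have "(\<lambda>(a, v). r a v) \<in> borel_measurable (count_space {0, 1} \<Otimes>\<^sub>M borel)"
    using r by (simp add: is_regression_def)
  from measurable_compose[OF measurable_Pair1'[of a "count_space {0,1}" borel] this] a
  show "r a \<in> borel_measurable borel" by simp
  have "integrable M (\<lambda>\<omega>. indicator B (V \<omega>) * (indicator (arm M A a) \<omega> * r a (V \<omega>))) \<and>
    (\<integral>\<omega>. indicator B (V \<omega>) * (indicator (arm M A a) \<omega> * Y \<omega>) \<partial>M)
      = (\<integral>\<omega>. indicator B (V \<omega>) * (indicator (arm M A a) \<omega> * r a (V \<omega>)) \<partial>M)"
    if [measurable]: "B \<in> sets borel" for B
  proof -
    let ?f = "\<lambda>(a', v). indicator {a} a' * indicator B v :: real"
    have f: "?f \<in> borel_measurable (count_space {0, 1} \<Otimes>\<^sub>M borel)"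
      unfolding split_beta
      using a by (intro borel_measurable_times measurable_compose[OF measurable_fst]
          measurable_compose[OF measurable_snd] borel_measurable_indicator that) simp_all
    have W: "(\<lambda>\<omega>. (A \<omega>, V \<omega>)) \<in> M \<rightarrow>\<^sub>M count_space {0, 1} \<Otimes>\<^sub>M borel" by measurable
    have Ym: "Y \<in> borel_measurable M" using Y by simp
    have [measurable]: "arm M A a \<in> sets M" by (rule sets_arm) fact+
    have eq1: "?f (A \<omega>, V \<omega>) * x = indicator B (V \<omega>) * (indicator (arm M A a) \<omega> * x)"
      if "\<omega> \<in> space M" for \<omega> x using that by (simp add: indicator_arm_eq)
    have eq2: "?f (A \<omega>, V \<omega>) * (case (A \<omega>, V \<omega>) of (a, v) \<Rightarrow> r a v)
        = indicator B (V \<omega>) * (indicator (arm M A a) \<omega> * r a (V \<omega>))"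
      if "\<omega> \<in> space M" for \<omega> using that by (auto simp: indicator_arm_eq split: split_indicator)
    have "integrable M (\<lambda>\<omega>. indicator B (V \<omega>) * (indicator (arm M A a) \<omega> * Y \<omega>))"
      by (rule Bochner_Integration.integrable_bound[OF Y]) (use Ym in \<open>auto split: split_indicator\<close>)
    then have int: "integrable M (\<lambda>\<omega>. ?f (A \<omega>, V \<omega>) * Y \<omega>)"
      by (subst Bochner_Integration.integrable_cong[OF refl eq1])
    note R = regression_integral[OF \<open>prob_space M\<close> W r Ym f int]
    from R(1) have "integrable M (\<lambda>\<omega>. indicator B (V \<omega>) * (indicator (arm M A a) \<omega> * r a (V \<omega>)))"
      by (subst Bochner_Integration.integrable_cong[OF refl eq2[symmetric]])
    moreover have "(\<integral>\<omega>. indicator B (V \<omega>) * (indicator (arm M A a) \<omega> * Y \<omega>) \<partial>M)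
      = (\<integral>\<omega>. indicator B (V \<omega>) * (indicator (arm M A a) \<omega> * r a (V \<omega>)) \<partial>M)"
      by (rule box_equals[OF R(2) Bochner_Integration.integral_cong[OF refl eq1]
            Bochner_Integration.integral_cong[OF refl eq2]])
    ultimately show ?thesis ..
  qed
  \<comment> \<open>Taking \<open>UNIV\<close> makes the test indicator constantly one, which gives
    the integrability claim.\<close>
  note this[of UNIV] this[of B]
  then show "integrable M (\<lambda>\<omega>. indicator (arm M A a) \<omega> * r a (V \<omega>))"
    "B \<in> sets borel \<Longrightarrow> (\<integral>\<omega>. indicator B (V \<omega>) * (indicator (arm M A a) \<omega> * Y \<omega>) \<partial>M)
      = (\<integral>\<omega>. indicator B (V \<omega>) * (indicator (arm M A a) \<omega> * r a (V \<omega>)) \<partial>M)"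
    by simp_all
qed

text \<open>Exchangeability makes \<open>m a\<close>, which is only observed on the arm \<open>a\<close>, a regression of the
  potential outcome on the whole population; this is where positivity given \<open>U\<close> enters.\<close>

lemma outcome_regression:
  fixes A :: "'a \<Rightarrow> nat" and m :: "nat \<Rightarrow> real \<Rightarrow> real" and X Y :: "'a \<Rightarrow> real"
  assumes prob: "prob_space M" and A[measurable]: "A \<in> M \<rightarrow>\<^sub>M count_space {0, 1}"
    and U[measurable]: "U \<in> borel_measurable M" and X: "integrable M X" and Y: "integrable M Y"
    and XY: "\<And>\<omega>. \<omega> \<in> arm M A a \<Longrightarrow> Y \<omega> = X \<omega>"
    and ci: "cond_indep M (count_space {0, 1}) A borel X borel U"
    and m: "is_regression M Y (\<lambda>\<omega>. (A \<omega>, U \<omega>)) (count_space {0, 1} \<Otimes>\<^sub>M borel) (\<lambda>(a, u). m a u)"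
    and pos: "AE \<omega> in M. 0 < cond_prob_given M (arm M A a) U borel \<omega>"
    and a: "a \<in> {0, 1}"
  shows "integrable M (\<lambda>\<omega>. m a (U \<omega>))"
    and "a' \<in> {0, 1} \<Longrightarrow>
      (\<integral>\<omega>. indicator (arm M A a') \<omega> * X \<omega> \<partial>M) = (\<integral>\<omega>. indicator (arm M A a') \<omega> * m a (U \<omega>) \<partial>M)"
proof -
  let ?F = "vimage_algebra (space M) U borel"
  interpret sigma_finite_subalgebra M ?F
    by (rule sigma_finite_subalgebra_vimage_algebra) fact+
  have arm_sets[measurable]: "arm M A c \<in> sets M" if "c \<in> {0, 1}" for c
    by (rule sets_arm) fact+
  note R = arm_regression[OF prob A U Y m a]
  \<comment> \<open>The mean of the potential outcome given \<open>U\<close> in the whole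
    population, to be identified with \<open>m a\<close> at \<open>U\<close>.\<close>
  define n where "n = cond_exp_given M X U borel"
  have n: "integrable M n" "n \<in> borel_measurable ?F"
    unfolding n_def cond_exp_given_def using X by auto
  \<comment> \<open>Exchangeability: on either arm, \<open>X\<close> may be replaced by its mean
    given \<open>U\<close> alone.\<close>
  have n_arm: "(\<integral>\<omega>. indicator D \<omega> * (indicator (arm M A c) \<omega> * X \<omega>) \<partial>M)
      = (\<integral>\<omega>. indicator D \<omega> * (indicator (arm M A c) \<omega> * n \<omega>) \<partial>M)"
    if "D \<in> sets ?F" "c \<in> {0, 1}" for D c
  proof -
    have "{c} \<in> sets (count_space {0, 1})" using that(2) by simp
    from cond_indep_integral[OF prob ci X this that(1)] show ?thesis
      by (simp add: n_def mult.assoc indicator_arm_eq cong: Bochner_Integration.integral_cong)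
  qed
  let ?p = "indicator (arm M A a) :: 'a \<Rightarrow> real"
  have np: "integrable M (\<lambda>\<omega>. ?p \<omega> * n \<omega>)"
    using integrable_mult_indicator[OF arm_sets[OF a] n(1)] by simp
  \<comment> \<open>On the arm \<open>a\<close> the observed outcome is \<open>X\<close>, so
    \<open>n\<close> and \<open>m a\<close> at \<open>U\<close> have the same integrals there over
    events of \<open>U\<close>; positivity extends their equality to the whole population.\<close>
  have "AE \<omega> in M. n \<omega> - m a (U \<omega>) = 0"
  proof (rule AE_zero_if_weighted_integral_zero[where p = "?p"])
    show "(\<lambda>\<omega>. n \<omega> - m a (U \<omega>)) \<in> borel_measurable ?F"
      using n(2) R(1) U by (intro borel_measurable_diff measurable_vimage_algebra_compose)
    show "integrable M (\<lambda>\<omega>. (n \<omega> - m a (U \<omega>)) * ?p \<omega>)"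
      using Bochner_Integration.integrable_diff[OF np R(2)] by (simp add: algebra_simps)
    show "AE \<omega> in M. 0 < real_cond_exp M ?F ?p \<omega>"
      using pos by (simp add: cond_prob_given_def cond_exp_given_def)
    fix D assume D: "D \<in> sets ?F"
    then obtain B where B: "B \<in> sets borel" "D = U -` B \<inter> space M"
      by (subst (asm) sets_vimage_algebra2) auto
    have DM: "D \<in> sets M" using D subalg by (auto simp: subalgebra_def)
    have ind: "indicator D \<omega> = (indicator B (U \<omega>) :: real)" if "\<omega> \<in> space M" for \<omega>
      using that B by (simp add: indicator_def)
    have "(\<integral>\<omega>. indicator D \<omega> * (?p \<omega> * n \<omega>) \<partial>M) = (\<integral>\<omega>. indicator D \<omega> * (?p \<omega> * X \<omega>) \<partial>M)"
      using n_arm[OF D a] by simp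
    also have "\<dots> = (\<integral>\<omega>. indicator B (U \<omega>) * (?p \<omega> * Y \<omega>) \<partial>M)"
      by (intro Bochner_Integration.integral_cong) (auto simp: ind XY split: split_indicator)
    also have "\<dots> = (\<integral>\<omega>. indicator D \<omega> * (?p \<omega> * m a (U \<omega>)) \<partial>M)"
      using R(3)[OF B(1)] by (simp add: ind cong: Bochner_Integration.integral_cong)
    finally have "(\<integral>\<omega>. indicator D \<omega> * (?p \<omega> * n \<omega>) - indicator D \<omega> * (?p \<omega> * m a (U \<omega>)) \<partial>M) = 0"
      using integrable_mult_indicator[OF DM np] integrable_mult_indicator[OF DM R(2)] by simp
    then show "(\<integral>\<omega>. indicator D \<omega> * ((n \<omega> - m a (U \<omega>)) * ?p \<omega>) \<partial>M) = 0"
      by (simp add: algebra_simps)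
  qed (use a in simp)
  then have nm: "AE \<omega> in M. n \<omega> = m a (U \<omega>)" by simp
  have [measurable]: "m a \<in> borel_measurable borel" by fact
  have [measurable]: "n \<in> borel_measurable M" using n(1) by simp
  show "integrable M (\<lambda>\<omega>. m a (U \<omega>))"
    using n(1) integrable_cong_AE[OF _ _ nm] by simp
  assume a': "a' \<in> {0, 1}"
  \<comment> \<open>Valid for both arms, in particular for the one on which \<open>X\<close> is not
    observed.\<close>
  have "(\<integral>\<omega>. indicator (arm M A a') \<omega> * X \<omega> \<partial>M) = (\<integral>\<omega>. indicator (arm M A a') \<omega> * n \<omega> \<partial>M)"
  proof -
    have "indicator (space M) \<omega> * x = x" if "\<omega> \<in> space M" for \<omega> and x :: real using that by simp
    moreover have "space M \<in> sets ?F" using sets.top[of ?F] by simp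
    ultimately show ?thesis using n_arm[OF _ a', of "space M"]
      by (simp cong: Bochner_Integration.integral_cong)
  qed
  also have "\<dots> = (\<integral>\<omega>. indicator (arm M A a') \<omega> * m a (U \<omega>) \<partial>M)"
    using nm a' by (intro integral_cong_AE) (auto elim!: eventually_mono)
  finally show "(\<integral>\<omega>. indicator (arm M A a') \<omega> * X \<omega> \<partial>M)
      = (\<integral>\<omega>. indicator (arm M A a') \<omega> * m a (U \<omega>) \<partial>M)" .
qed

text \<open>Given \<open>A\<close> and \<open>U\<close>, the instrument carries no information on
  \<open>Y\<close>, so \<open>m a\<close> at \<open>U\<close> replaces \<open>Y\<close> on the arm
  even under a test function of \<open>Z\<close>. The arm is itself an event of the pair
  \<open>(A, U)\<close> and plays the role of \<open>D\<close> in
  \<open>cond_indep_integral\<close>.\<close>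

lemma arm_integral_exclusion:
  fixes A :: "'a \<Rightarrow> nat" and m :: "nat \<Rightarrow> real \<Rightarrow> real" and Y :: "'a \<Rightarrow> real"
  assumes prob: "prob_space M" and A[measurable]: "A \<in> M \<rightarrow>\<^sub>M count_space {0, 1}"
    and U[measurable]: "U \<in> borel_measurable M" and Y: "integrable M Y"
    and ci: "cond_indep M borel Z borel Y (count_space {0, 1} \<Otimes>\<^sub>M borel) (\<lambda>\<omega>. (A \<omega>, U \<omega>))"
    and m: "is_regression M Y (\<lambda>\<omega>. (A \<omega>, U \<omega>)) (count_space {0, 1} \<Otimes>\<^sub>M borel) (\<lambda>(a, u). m a u)"
    and a: "a \<in> {0, 1}" and B[measurable]: "B \<in> sets borel"
  shows "(\<integral>\<omega>. indicator B (Z \<omega>) * (indicator (arm M A a) \<omega> * Y \<omega>) \<partial>M)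
    = (\<integral>\<omega>. indicator B (Z \<omega>) * (indicator (arm M A a) \<omega> * m a (U \<omega>)) \<partial>M)"
proof -
  let ?S = "count_space {0, 1} \<Otimes>\<^sub>M borel" and ?W = "\<lambda>\<omega>. (A \<omega>, U \<omega>)"
  have [measurable]: "Z \<in> borel_measurable M" using ci by (simp add: cond_indep_def)
  have [measurable]: "arm M A a \<in> sets M" by (rule sets_arm) fact+
  have [measurable]: "m a \<in> borel_measurable borel" by (rule arm_regression(1)) fact+
  have "{a} \<times> UNIV \<in> sets ?S" using a by (intro pair_measureI) auto
  then have "?W -` ({a} \<times> UNIV) \<inter> space M \<in> sets (vimage_algebra (space M) ?W ?S)"
    by (rule in_vimage_algebra)
  also have "?W -` ({a} \<times> UNIV) \<inter> space M = arm M A a" by (auto simp: arm_def)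
  finally have "(\<integral>\<omega>. indicator (arm M A a) \<omega> * indicator B (Z \<omega>) * Y \<omega> \<partial>M)
      = (\<integral>\<omega>. indicator (arm M A a) \<omega> * indicator B (Z \<omega>) * cond_exp_given M Y ?W ?S \<omega> \<partial>M)"
    by (rule cond_indep_integral[OF prob ci Y B])
  also have "\<dots> = (\<integral>\<omega>. indicator (arm M A a) \<omega> * indicator B (Z \<omega>) * m a (U \<omega>) \<partial>M)"
  proof (rule integral_cong_AE)
    have "AE \<omega> in M. cond_exp_given M Y ?W ?S \<omega> = m (A \<omega>) (U \<omega>)"
      using m by (simp add: is_regression_def)
    then show "AE \<omega> in M. indicator (arm M A a) \<omega> * indicator B (Z \<omega>) * cond_exp_given M Y ?W ?S \<omega>
        = indicator (arm M A a) \<omega> * indicator B (Z \<omega>) * m a (U \<omega>)"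
      by eventually_elim (auto simp: arm_def split: split_indicator)
  qed (simp_all add: cond_exp_given_def)
  finally show ?thesis by (simp add: mult_ac)
qed

section \<open>Factorisation of integrals under a product propensity\<close>

text \<open>The indicator of \<open>E\<close> is replaced by its propensity, after which
  independence splits the integral. Measurability and integrability are known at first for the
  product only and have to be extracted for each factor; \<open>nz\<close> ensures that neither
  factor vanishes almost surely.\<close>

lemma propensity_integral:
  fixes Z U :: "'a \<Rightarrow> real" and \<beta> \<gamma> f g :: "real \<Rightarrow> real"
  assumes prob: "prob_space M" and indep: "prob_space.indep_var M borel Z borel U"
    and E[measurable]: "E \<in> sets M"
    and reg: "is_regression M (indicator E) (\<lambda>\<omega>. (Z \<omega>, U \<omega>)) (borel \<Otimes>\<^sub>M borel) (\<lambda>(z, u). \<beta> z * \<gamma> u)"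
    and nz: "measure M E \<noteq> 0"
  shows "\<beta> \<in> borel_measurable borel" "\<gamma> \<in> borel_measurable borel"
    and "f \<in> borel_measurable borel \<Longrightarrow> integrable M (\<lambda>\<omega>. f (Z \<omega>)) \<Longrightarrow>
      integrable M (\<lambda>\<omega>. f (Z \<omega>) * \<beta> (Z \<omega>))"
    and "g \<in> borel_measurable borel \<Longrightarrow> integrable M (\<lambda>\<omega>. g (U \<omega>)) \<Longrightarrow>
      integrable M (\<lambda>\<omega>. g (U \<omega>) * \<gamma> (U \<omega>))"
    and "f \<in> borel_measurable borel \<Longrightarrow> integrable M (\<lambda>\<omega>. f (Z \<omega>)) \<Longrightarrow>
      g \<in> borel_measurable borel \<Longrightarrow> integrable M (\<lambda>\<omega>. g (U \<omega>)) \<Longrightarrow>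
      (\<integral>\<omega>. f (Z \<omega>) * (indicator E \<omega> * g (U \<omega>)) \<partial>M)
        = (\<integral>\<omega>. f (Z \<omega>) * \<beta> (Z \<omega>) \<partial>M) * (\<integral>\<omega>. g (U \<omega>) * \<gamma> (U \<omega>) \<partial>M)"
proof -
  interpret prob_space M by fact
  have [measurable]: "Z \<in> borel_measurable M" "U \<in> borel_measurable M"
    using indep indep_var_rv1 indep_var_rv2 by blast+
  have W: "(\<lambda>\<omega>. (Z \<omega>, U \<omega>)) \<in> M \<rightarrow>\<^sub>M borel \<Otimes>\<^sub>M borel" by measurable
  have prod: "integrable M (\<lambda>\<omega>. (f (Z \<omega>) * \<beta> (Z \<omega>)) * (g (U \<omega>) * \<gamma> (U \<omega>)))"
    "(\<integral>\<omega>. f (Z \<omega>) * (indicator E \<omega> * g (U \<omega>)) \<partial>M)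
      = (\<integral>\<omega>. (f (Z \<omega>) * \<beta> (Z \<omega>)) * (g (U \<omega>) * \<gamma> (U \<omega>)) \<partial>M)"
    if [measurable]: "f \<in> borel_measurable borel" "g \<in> borel_measurable borel"
      and int: "integrable M (\<lambda>\<omega>. f (Z \<omega>))" "integrable M (\<lambda>\<omega>. g (U \<omega>))" for f g
  proof -
    have "indep_var borel (f \<circ> Z) borel (g \<circ> U)"
      by (rule indep_var_compose[OF indep]) measurable
    from indep_var_integrable[OF this] int have "integrable M (\<lambda>\<omega>. f (Z \<omega>) * g (U \<omega>))"
      by (simp add: comp_def)
    from integrable_mult_indicator[OF E this]
    have "integrable M (\<lambda>\<omega>. (case (Z \<omega>, U \<omega>) of (z, u) \<Rightarrow> f z * g u) * indicator E \<omega>)"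
      by (simp add: mult_ac)
    note regression_integral[OF prob W reg _ _ this]
    then show "integrable M (\<lambda>\<omega>. (f (Z \<omega>) * \<beta> (Z \<omega>)) * (g (U \<omega>) * \<gamma> (U \<omega>)))"
      "(\<integral>\<omega>. f (Z \<omega>) * (indicator E \<omega> * g (U \<omega>)) \<partial>M)
        = (\<integral>\<omega>. (f (Z \<omega>) * \<beta> (Z \<omega>)) * (g (U \<omega>) * \<gamma> (U \<omega>)) \<partial>M)"
      by (simp_all add: mult_ac)
  qed
  \<comment> \<open>The case of constant test functions 1: the propensity integrates to the nonzero
    probability of \<open>E\<close>, so it is not almost surely zero.\<close>
  have "measure M E = (\<integral>\<omega>. 1 * (indicator E \<omega> * 1) \<partial>M)" by simp
  also have "\<dots> = (\<integral>\<omega>. (1 * \<beta> (Z \<omega>)) * (1 * \<gamma> (U \<omega>)) \<partial>M)"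
    by (rule prod(2)) simp_all
  finally have "(\<integral>\<omega>. \<beta> (Z \<omega>) * \<gamma> (U \<omega>) \<partial>M) \<noteq> 0" using nz by simp
  then have notae: "\<not> (AE \<omega> in M. \<beta> (Z \<omega>) * \<gamma> (U \<omega>) = 0)"
    by (rule contrapos_nn[OF _ integral_eq_zero_AE])
  have "\<not> (\<forall>\<omega>. \<beta> (Z \<omega>) * \<gamma> (U \<omega>) = 0)"
  proof
    assume "\<forall>\<omega>. \<beta> (Z \<omega>) * \<gamma> (U \<omega>) = 0"
    then have "AE \<omega> in M. \<beta> (Z \<omega>) * \<gamma> (U \<omega>) = 0" by (intro AE_I2) blast
    with notae show False ..
  qed
  \<comment> \<open>Both factors are nonzero at this point, so each of them is a section of the
    measurable product divided by a nonzero constant.\<close>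
  then obtain \<omega>\<^sub>0 where pt: "\<beta> (Z \<omega>\<^sub>0) \<noteq> 0" "\<gamma> (U \<omega>\<^sub>0) \<noteq> 0"
    by auto
  have pm: "(\<lambda>(z, u). \<beta> z * \<gamma> u) \<in> borel_measurable (borel \<Otimes>\<^sub>M borel)"
    using reg by (simp add: is_regression_def)
  from borel_measurable_divide[OF measurable_compose[OF measurable_Pair2'[of "U \<omega>\<^sub>0" borel borel] pm]
      borel_measurable_const[of "\<gamma> (U \<omega>\<^sub>0)"]] pt(2)
  show \<beta>[measurable]: "\<beta> \<in> borel_measurable borel" by simp
  from borel_measurable_divide[OF measurable_compose[OF measurable_Pair1'[of "Z \<omega>\<^sub>0" borel borel] pm]
      borel_measurable_const[of "\<beta> (Z \<omega>\<^sub>0)"]] pt(1)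
  show \<gamma>[measurable]: "\<gamma> \<in> borel_measurable borel" by simp
  have \<beta>nz: "\<not> (AE \<omega> in M. \<beta> (Z \<omega>) = 0)" and \<gamma>nz: "\<not> (AE \<omega> in M. \<gamma> (U \<omega>) = 0)"
    by (rule contrapos_nn[OF notae], erule eventually_mono, simp)+
  show f\<beta>: "integrable M (\<lambda>\<omega>. f (Z \<omega>) * \<beta> (Z \<omega>))"
    if f[measurable]: "f \<in> borel_measurable borel" and int: "integrable M (\<lambda>\<omega>. f (Z \<omega>))" for f
  proof (rule indep_var_integrable_factor(1)[OF _ _ \<gamma>nz])
    show "integrable M (\<lambda>\<omega>. (f (Z \<omega>) * \<beta> (Z \<omega>)) * \<gamma> (U \<omega>))"
      using prod(1)[of f "\<lambda>_. 1", OF f borel_measurable_const int integrable_const] by simp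
    have "indep_var borel ((\<lambda>z. f z * \<beta> z) \<circ> Z) borel (\<gamma> \<circ> U)"
      by (rule indep_var_compose[OF indep]) measurable
    then show "indep_var borel (\<lambda>\<omega>. f (Z \<omega>) * \<beta> (Z \<omega>)) borel (\<lambda>\<omega>. \<gamma> (U \<omega>))"
      by (simp add: comp_def)
  qed
  show g\<gamma>: "integrable M (\<lambda>\<omega>. g (U \<omega>) * \<gamma> (U \<omega>))"
    if g[measurable]: "g \<in> borel_measurable borel" and int: "integrable M (\<lambda>\<omega>. g (U \<omega>))" for g
  proof (rule indep_var_integrable_factor(2)[OF _ _ \<beta>nz])
    show "integrable M (\<lambda>\<omega>. \<beta> (Z \<omega>) * (g (U \<omega>) * \<gamma> (U \<omega>)))"
      using prod(1)[of "\<lambda>_. 1" g, OF borel_measurable_const g integrable_const int] by simp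
    have "indep_var borel (\<beta> \<circ> Z) borel ((\<lambda>z. g z * \<gamma> z) \<circ> U)"
      by (rule indep_var_compose[OF indep]) measurable
    then show "indep_var borel (\<lambda>\<omega>. \<beta> (Z \<omega>)) borel (\<lambda>\<omega>. g (U \<omega>) * \<gamma> (U \<omega>))"
      by (simp add: comp_def)
  qed
  show "(\<integral>\<omega>. f (Z \<omega>) * (indicator E \<omega> * g (U \<omega>)) \<partial>M)
      = (\<integral>\<omega>. f (Z \<omega>) * \<beta> (Z \<omega>) \<partial>M) * (\<integral>\<omega>. g (U \<omega>) * \<gamma> (U \<omega>) \<partial>M)"
    if f[measurable]: "f \<in> borel_measurable borel" and fi: "integrable M (\<lambda>\<omega>. f (Z \<omega>))"
      and g[measurable]: "g \<in> borel_measurable borel" and gi: "integrable M (\<lambda>\<omega>. g (U \<omega>))"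
  proof -
    have "indep_var borel ((\<lambda>z. f z * \<beta> z) \<circ> Z) borel ((\<lambda>z. g z * \<gamma> z) \<circ> U)"
      by (rule indep_var_compose[OF indep]) measurable
    from indep_var_lebesgue_integral[OF this] f\<beta>[OF f fi] g\<gamma>[OF g gi]
    show ?thesis unfolding prod(2)[OF f g fi gi] by (simp add: comp_def)
  qed
qed

theorem theorem3:
  fixes M :: "'a measure"
    and A :: "'a \<Rightarrow> nat"
    and Z U Y :: "'a \<Rightarrow> real"
    and Yp :: "nat \<Rightarrow> 'a \<Rightarrow> real"
    and \<beta> \<gamma> :: "real \<Rightarrow> real"
    and m \<mu> :: "nat \<Rightarrow> real \<Rightarrow> real"
    and K :: "nat \<times> real \<Rightarrow> real measure"
  assumes prob: "prob_space M"
    and A_rv: "A \<in> M \<rightarrow>\<^sub>M count_space {0, 1}"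
    and Z_rv: "Z \<in> borel_measurable M"
    and U_rv: "U \<in> borel_measurable M"
    and Yp_int: "\<And>a. a \<in> {0, 1} \<Longrightarrow> integrable M (Yp a)"
    and Y_def: "\<And>\<omega>. \<omega> \<in> space M \<Longrightarrow>
          Y \<omega> = real (A \<omega>) * Yp 1 \<omega> + (1 - real (A \<omega>)) * Yp 0 \<omega>"
    \<comment> \<open>the causal diagram\<close>
    and Z_indep_U: "prob_space.indep_var M borel Z borel U"
    and Z_indep_Y: "cond_indep M borel Z borel Y (count_space {0, 1} \<Otimes>\<^sub>M borel) (\<lambda>\<omega>. (A \<omega>, U \<omega>))"
    and Z_dep_A: "\<not> prob_space.indep_var M borel Z borel (\<lambda>\<omega>. real (A \<omega>))"
    and A_indep_Yp: "\<And>a. a \<in> {0, 1} \<Longrightarrow>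
          cond_indep M (count_space {0, 1}) A borel (Yp a) borel U"
    \<comment> \<open>conditioning on \<open>(A = a, U = u)\<close> and on \<open>(A = a, Z = z)\<close> is well defined\<close>
    and pos_U: "\<And>a. a \<in> {0, 1} \<Longrightarrow> AE \<omega> in M. 0 < cond_prob_given M (arm M A a) U borel \<omega>"
    and pos_Z: "\<And>a. a \<in> {0, 1} \<Longrightarrow> AE \<omega> in M. 0 < cond_prob_given M (arm M A a) Z borel \<omega>"
    \<comment> \<open>\<open>m a u = E(Y | A = a, U = u)\<close> and \<open>\<mu> a z = E(Y | A = a, Z = z)\<close>\<close>
    and m: "is_regression M Y (\<lambda>\<omega>. (A \<omega>, U \<omega>)) (count_space {0, 1} \<Otimes>\<^sub>M borel) (\<lambda>(a, u). m a u)"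
    and \<mu>: "is_regression M Y (\<lambda>\<omega>. (A \<omega>, Z \<omega>)) (count_space {0, 1} \<Otimes>\<^sub>M borel) (\<lambda>(a, z). \<mu> a z)"
    and \<mu>_int: "\<And>a. a \<in> {0, 1} \<Longrightarrow> integrable (distr M borel Z) (\<mu> a)"
    \<comment> \<open>(a')\<close>
    and propensity: "is_regression M (indicator (arm M A 1)) (\<lambda>\<omega>. (Z \<omega>, U \<omega>)) (borel \<Otimes>\<^sub>M borel)
          (\<lambda>(z, u). \<beta> z * \<gamma> u)"
    and \<beta>_nonneg: "AE z in distr M borel Z. 0 \<le> \<beta> z"
    and \<gamma>_nonneg: "AE u in distr M borel U. 0 \<le> \<gamma> u"
    \<comment> \<open>(b)\<close>
    and \<beta>_mono: "ae_nondecreasing (distr M borel Z) \<beta>"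
    and \<gamma>_mono: "ae_nondecreasing (distr M borel U) \<gamma>"
    and m_mono: "\<And>a. a \<in> {0, 1} \<Longrightarrow> ae_nondecreasing (distr M borel U) (m a)"
    \<comment> \<open>(c)\<close>
    and K: "is_cond_distr M U (\<lambda>\<omega>. (A \<omega>, Z \<omega>)) (count_space {0, 1} \<Otimes>\<^sub>M borel) K"
    and esssup_U: "\<exists>s :: nat \<Rightarrow> ereal. AE \<omega> in M. esssup (K (A \<omega>, Z \<omega>)) ereal = s (A \<omega>)"
  shows "ACE1_adj M A Z Y \<mu> \<ge> ACE_unadj M A Y \<and> ACE_unadj M A Y \<ge> ACE_true_arm M A Yp 1 \<and>
         ACE0_adj M A Z Y \<mu> \<ge> ACE_unadj M A Y \<and> ACE_unadj M A Y \<ge> ACE_true_arm M A Yp 0 \<and>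
         ACE_adj M Z \<mu> \<ge> ACE_unadj M A Y \<and> ACE_unadj M A Y \<ge> ACE_true M Yp"
proof -

  \<comment> \<open>Observed outcome and positivity of the arms\<close>
  interpret prob_space M by (rule prob)
  note [measurable] = A_rv Z_rv U_rv
  have arm_sets[measurable]: "arm M A a \<in> sets M" if "a \<in> {0, 1}" for a
    by (rule sets_arm[OF A_rv that])
  let ?p = "\<lambda>a. indicator (arm M A a) :: 'a \<Rightarrow> real"
  have p_int: "integrable M (?p a)" if "a \<in> {0, 1}" for a
    using arm_sets[OF that] by (intro integrable_const_bound[where B = 1]) auto
  have A01: "A \<omega> \<in> {0, 1}" if "\<omega> \<in> space M" for \<omega>
    using measurable_space[OF A_rv that] by simp
  have p0: "?p 0 \<omega> = 1 - ?p 1 \<omega>" if "\<omega> \<in> space M" for \<omega>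
    using A01[OF that] that by (auto simp: arm_def indicator_def)

  have Y_arm: "Y \<omega> = Yp a \<omega>" if "\<omega> \<in> arm M A a" "a \<in> {0, 1}" for a \<omega>
    using that Y_def[of \<omega>] by (auto simp: arm_def)
  have Y_int: "integrable M Y"
  proof -
    have "integrable M (\<lambda>\<omega>. ?p 1 \<omega> * Yp 1 \<omega> + ?p 0 \<omega> * Yp 0 \<omega>)"
      using integrable_mult_indicator[OF arm_sets[of 1] Yp_int[of 1]]
        integrable_mult_indicator[OF arm_sets[of 0] Yp_int[of 0]] by simp
    moreover have "?p 1 \<omega> * Yp 1 \<omega> + ?p 0 \<omega> * Yp 0 \<omega> = Y \<omega>" if "\<omega> \<in> space M" for \<omega>
      using A01[OF that] that Y_def[OF that] by (auto simp: arm_def indicator_def)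
    ultimately show ?thesis by (simp cong: Bochner_Integration.integrable_cong)
  qed

  \<comment> \<open>The conditional probability given \<open>U\<close> integrates to the probability
    of the arm, and an almost surely positive function cannot have integral zero.\<close>
  have P_pos: "0 < measure M (arm M A a)" if a: "a \<in> {0, 1}" for a
  proof -
    interpret U: sigma_finite_subalgebra M "vimage_algebra (space M) U borel"
      by (rule sigma_finite_subalgebra_vimage_algebra[OF prob U_rv])
    let ?q = "cond_prob_given M (arm M A a) U borel"
    have q: "integrable M ?q" "expectation ?q = measure M (arm M A a)"
      using U.real_cond_exp_int[OF p_int[OF a]] arm_sets[OF a]
      by (simp_all add: cond_prob_given_def cond_exp_given_def)
    have "AE \<omega> in M. 0 \<le> ?q \<omega>" using pos_U[OF a] by eventually_elim simp
    moreover have "\<not> (AE \<omega> in M. ?q \<omega> = 0)"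
    proof
      assume "AE \<omega> in M. ?q \<omega> = 0"
      with pos_U[OF a] have "AE \<omega> in M. False" by eventually_elim simp
      then show False by simp
    qed
    ultimately have "measure M (arm M A a) \<noteq> 0"
      using integral_nonneg_eq_0_iff_AE[OF q(1)] q(2) by simp
    then show ?thesis by (simp add: zero_less_measure_iff)
  qed

  \<comment> \<open>Integrals over the two arms\<close>
  note m_reg = arm_regression[OF prob A_rv U_rv Y_int m]
  note \<mu>_reg = arm_regression[OF prob A_rv Z_rv Y_int \<mu>]
  have [measurable]: "m a \<in> borel_measurable borel" "\<mu> a \<in> borel_measurable borel"
    if "a \<in> {0, 1}" for a using m_reg(1) \<mu>_reg(1) that by blast+
  have m_int: "integrable M (\<lambda>\<omega>. m a (U \<omega>))"
    and Yp_m: "a' \<in> {0, 1} \<Longrightarrow> (\<integral>\<omega>. ?p a' \<omega> * Yp a \<omega> \<partial>M) = (\<integral>\<omega>. ?p a' \<omega> * m a (U \<omega>) \<partial>M)"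
    if a: "a \<in> {0, 1}" for a a'
    using outcome_regression[OF prob A_rv U_rv Yp_int[OF a] Y_int Y_arm[OF _ a] A_indep_Yp[OF a] m
        pos_U[OF a] a] by blast+
  have \<mu>Z_int: "integrable M (\<lambda>\<omega>. \<mu> a (Z \<omega>))" if "a \<in> {0, 1}" for a
    using integrable_distr[OF Z_rv \<mu>_int[OF that]] .
  have p1_sets: "arm M A 1 \<in> sets M" and P1_nz: "measure M (arm M A 1) \<noteq> 0"
    using arm_sets[of 1] P_pos[of 1] by auto
  note prop_int = propensity_integral[OF prob Z_indep_U p1_sets propensity P1_nz]
  note [measurable] = prop_int(1,2)
  have \<beta>_int: "integrable M (\<lambda>\<omega>. \<beta> (Z \<omega>))"
    using prop_int(3)[OF borel_measurable_const[of 1] integrable_const] by simp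
  have \<gamma>_int: "integrable M (\<lambda>\<omega>. \<gamma> (U \<omega>))"
    using prop_int(4)[OF borel_measurable_const[of 1] integrable_const] by simp
  \<comment> \<open>These formulas evaluate the arm integrals below; the second subtracts the first
    from the factorised integral over both arms.\<close>
  have arm1: "(\<integral>\<omega>. f (Z \<omega>) * (?p 1 \<omega> * g (U \<omega>)) \<partial>M)
      = (\<integral>\<omega>. f (Z \<omega>) * \<beta> (Z \<omega>) \<partial>M) * (\<integral>\<omega>. g (U \<omega>) * \<gamma> (U \<omega>) \<partial>M)"
    and arm0: "(\<integral>\<omega>. f (Z \<omega>) * (?p 0 \<omega> * g (U \<omega>)) \<partial>M)
      = (\<integral>\<omega>. f (Z \<omega>) \<partial>M) * (\<integral>\<omega>. g (U \<omega>) \<partial>M)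
        - (\<integral>\<omega>. f (Z \<omega>) * \<beta> (Z \<omega>) \<partial>M) * (\<integral>\<omega>. g (U \<omega>) * \<gamma> (U \<omega>) \<partial>M)"
    if f[measurable]: "f \<in> borel_measurable borel" and fi: "integrable M (\<lambda>\<omega>. f (Z \<omega>))"
      and g[measurable]: "g \<in> borel_measurable borel" and gi: "integrable M (\<lambda>\<omega>. g (U \<omega>))" for f g
  proof -
    show 1: "(\<integral>\<omega>. f (Z \<omega>) * (?p 1 \<omega> * g (U \<omega>)) \<partial>M)
      = (\<integral>\<omega>. f (Z \<omega>) * \<beta> (Z \<omega>) \<partial>M) * (\<integral>\<omega>. g (U \<omega>) * \<gamma> (U \<omega>) \<partial>M)"
      by (rule prop_int(5)[OF f fi g gi])
    have "indep_var borel (f \<circ> Z) borel (g \<circ> U)"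
      by (rule indep_var_compose[OF Z_indep_U]) measurable
    from indep_var_integrable[OF this] indep_var_lebesgue_integral[OF this] fi gi
    have fg: "integrable M (\<lambda>\<omega>. f (Z \<omega>) * g (U \<omega>))"
      "(\<integral>\<omega>. f (Z \<omega>) * g (U \<omega>) \<partial>M) = (\<integral>\<omega>. f (Z \<omega>) \<partial>M) * (\<integral>\<omega>. g (U \<omega>) \<partial>M)"
      by (simp_all add: comp_def)
    have "(\<integral>\<omega>. f (Z \<omega>) * (?p 0 \<omega> * g (U \<omega>)) \<partial>M)
        = (\<integral>\<omega>. f (Z \<omega>) * g (U \<omega>) - f (Z \<omega>) * (?p 1 \<omega> * g (U \<omega>)) \<partial>M)"
      by (intro Bochner_Integration.integral_cong refl) (simp only: p0, simp add: algebra_simps)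
    also have "\<dots> = (\<integral>\<omega>. f (Z \<omega>) * g (U \<omega>) \<partial>M) - (\<integral>\<omega>. f (Z \<omega>) * (?p 1 \<omega> * g (U \<omega>)) \<partial>M)"
      using integrable_mult_indicator[OF p1_sets fg(1)] fg(1)
      by (intro Bochner_Integration.integral_diff) (simp_all add: mult_ac)
    finally show "(\<integral>\<omega>. f (Z \<omega>) * (?p 0 \<omega> * g (U \<omega>)) \<partial>M)
      = (\<integral>\<omega>. f (Z \<omega>) \<partial>M) * (\<integral>\<omega>. g (U \<omega>) \<partial>M)
        - (\<integral>\<omega>. f (Z \<omega>) * \<beta> (Z \<omega>) \<partial>M) * (\<integral>\<omega>. g (U \<omega>) * \<gamma> (U \<omega>) \<partial>M)"
      by (simp only: 1 fg(2))
  qed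

  \<comment> \<open>Reduction to numerical constants\<close>
  \<comment> \<open>The claims become inequalities between these reals: \<open>b * g\<close> is the
    treatment probability, \<open>h a / g\<close> the mean of \<open>Yp a\<close> on the treated
    arm, and \<open>k / b\<close> the mean of \<open>\<mu> 0\<close> at \<open>Z\<close> on that
    arm.\<close>
  define b g where "b = (\<integral>\<omega>. \<beta> (Z \<omega>) \<partial>M)" and "g = (\<integral>\<omega>. \<gamma> (U \<omega>) \<partial>M)"
  define e h where "e = (\<lambda>a. \<integral>\<omega>. m a (U \<omega>) \<partial>M)" and "h = (\<lambda>a. \<integral>\<omega>. m a (U \<omega>) * \<gamma> (U \<omega>) \<partial>M)"
  define n k where "n = (\<integral>\<omega>. \<mu> 0 (Z \<omega>) \<partial>M)" and "k = (\<integral>\<omega>. \<mu> 0 (Z \<omega>) * \<beta> (Z \<omega>) \<partial>M)"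
  have m\<gamma>_int: "integrable M (\<lambda>\<omega>. m a (U \<omega>) * \<gamma> (U \<omega>))" if "a \<in> {0, 1}" for a
    by (rule prop_int(4)[OF m_reg(1)[OF that] m_int[OF that]])
  have \<mu>\<beta>_int: "integrable M (\<lambda>\<omega>. \<mu> a (Z \<omega>) * \<beta> (Z \<omega>))" if "a \<in> {0, 1}" for a
    by (rule prop_int(3)[OF \<mu>_reg(1)[OF that] \<mu>Z_int[OF that]])
  have one: "(\<lambda>_. 1 :: real) \<in> borel_measurable borel" "integrable M (\<lambda>_. 1 :: real)" by auto

  have P1: "measure M (arm M A 1) = b * g"
    using arm1[OF one one] arm_sets[of 1] by (simp add: b_def g_def)
  have P0: "measure M (arm M A 0) = 1 - b * g"
    using arm0[OF one one] arm_sets[of 0] by (simp add: b_def g_def prob_space)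
  have p1_m: "(\<integral>\<omega>. ?p 1 \<omega> * m a (U \<omega>) \<partial>M) = b * h a"
    and p0_m: "(\<integral>\<omega>. ?p 0 \<omega> * m a (U \<omega>) \<partial>M) = e a - b * h a" if a: "a \<in> {0, 1}" for a
    using arm1[OF one m_reg(1)[OF a] m_int[OF a]] arm0[OF one m_reg(1)[OF a] m_int[OF a]]
    by (simp_all add: b_def h_def e_def prob_space)
  \<comment> \<open>A product propensity leaves a common change of sign open;
    \<open>b \<ge> 0\<close> and \<open>b * g > 0\<close> together settle both signs.\<close>
  have "b \<ge> 0" unfolding b_def
    using AE_distrD[OF Z_rv \<beta>_nonneg] by (rule integral_nonneg_AE)
  moreover have "b * g > 0" using P_pos[of 1] P1 by simp
  ultimately have b: "b > 0" and g: "g > 0"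
    by (auto simp: zero_less_mult_iff)
  have bg: "1 - b * g > 0" using P_pos[of 0] P0 by simp

  \<comment> \<open>The covariance of \<open>m a\<close> and \<open>\<gamma>\<close> at
    \<open>U\<close>: two functions that are non-decreasing on \<open>S1 \<inter> S2\<close> are
    comonotone there.\<close>
  have cov_U: "e a * g \<le> h a" if a: "a \<in> {0, 1}" for a
  proof -
    obtain S1 where S1: "AE u in distr M borel U. u \<in> S1" "mono_on S1 (m a)"
      using m_mono[OF a] by (auto simp: ae_nondecreasing_def)
    obtain S2 where S2: "AE u in distr M borel U. u \<in> S2" "mono_on S2 \<gamma>"
      using \<gamma>_mono by (auto simp: ae_nondecreasing_def)
    have "AE \<omega> in M. \<omega> \<in> {\<omega>. U \<omega> \<in> S1 \<inter> S2}"
      using AE_distrD[OF U_rv S1(1)] AE_distrD[OF U_rv S2(1)] by eventually_elim simp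
    moreover have "0 \<le> (m a (U x) - m a (U y)) * (\<gamma> (U x) - \<gamma> (U y))"
      if "x \<in> {\<omega>. U \<omega> \<in> S1 \<inter> S2}" "y \<in> {\<omega>. U \<omega> \<in> S1 \<inter> S2}" for x y
    proof (cases "U x \<le> U y")
      case True
      then show ?thesis using that S1(2) S2(2)
        by (intro mult_nonpos_nonpos) (auto simp: monotone_on_def)
    next
      case False
      then show ?thesis using that S1(2) S2(2)
        by (intro mult_nonneg_nonneg) (auto simp: monotone_on_def)
    qed
    ultimately show ?thesis unfolding e_def g_def h_def
      by (rule integral_mult_ge_if_comonotone[OF m_int[OF a] \<gamma>_int m\<gamma>_int[OF a]])
  qed

  \<comment> \<open>Regressions on the instrument\<close>
  have ind_int: "integrable M (\<lambda>\<omega>. indicator B (Z \<omega>) * f \<omega>)"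
    if "integrable M f" and [measurable]: "B \<in> sets borel" for B and f :: "'a \<Rightarrow> real"
  proof (rule Bochner_Integration.integrable_bound[OF that(1)])
    show "(\<lambda>\<omega>. indicator B (Z \<omega>) * f \<omega>) \<in> borel_measurable M"
      using borel_measurable_integrable[OF that(1)] by measurable
  qed (auto split: split_indicator)
  have B_meas: "(indicator B :: real \<Rightarrow> real) \<in> borel_measurable borel"
    "integrable M (\<lambda>\<omega>. indicator B (Z \<omega>) :: real)" if "B \<in> sets borel" for B :: "real set"
    using that ind_int[OF one(2) that] by simp_all
  have B\<mu>: "(\<lambda>z. indicator B z * \<mu> a z) \<in> borel_measurable borel"
    "integrable M (\<lambda>\<omega>. indicator B (Z \<omega>) * \<mu> a (Z \<omega>))"
    if "B \<in> sets borel" "a \<in> {0, 1}" for B :: "real set" and a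
    using that \<mu>_reg(1)[OF that(2)] ind_int[OF \<mu>Z_int[OF that(2)] that(1)] by simp_all
  have pY_int: "integrable M (\<lambda>\<omega>. ?p a \<omega> * Y \<omega>)" if "a \<in> {0, 1}" for a
    using integrable_mult_indicator[OF arm_sets[OF that] Y_int] by simp
  have Y_arm_m: "(\<integral>\<omega>. indicator B (Z \<omega>) * (?p a \<omega> * Y \<omega>) \<partial>M)
      = (\<integral>\<omega>. indicator B (Z \<omega>) * (?p a \<omega> * m a (U \<omega>)) \<partial>M)"
    if "B \<in> sets borel" "a \<in> {0, 1}" for B a
    by (rule arm_integral_exclusion[OF prob A_rv U_rv Y_int Z_indep_Y m that(2,1)])

  \<comment> \<open>Integrating \<open>U\<close> out of the propensity leaves
    \<open>\<beta> (Z \<omega>) * g\<close> as the treatment probability given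
    \<open>Z\<close>.\<close>
  have \<beta>Z_pos: "AE \<omega> in M. 0 < \<beta> (Z \<omega>) * g"
  proof -
    have "AE \<omega> in M. cond_exp_given M (?p 1) Z borel \<omega> = \<beta> (Z \<omega>) * g"
    proof (rule cond_exp_given_eqI[OF prob Z_rv])
      fix B :: "real set" assume B: "B \<in> sets borel"
      show "(\<integral>\<omega>. indicator B (Z \<omega>) * ?p 1 \<omega> \<partial>M) = (\<integral>\<omega>. indicator B (Z \<omega>) * (\<beta> (Z \<omega>) * g) \<partial>M)"
        using arm1[OF B_meas[OF B] one] by (simp add: g_def flip: mult.assoc)
    qed (use \<beta>_int p_int in simp_all)
    with pos_Z[of 1] show ?thesis by (auto simp: cond_prob_given_def)
  qed
  have \<beta>Z_less: "AE \<omega> in M. 0 < 1 - \<beta> (Z \<omega>) * g"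
  proof -
    have "AE \<omega> in M. cond_exp_given M (?p 0) Z borel \<omega> = 1 - \<beta> (Z \<omega>) * g"
    proof (rule cond_exp_given_eqI[OF prob Z_rv])
      fix B :: "real set" assume B: "B \<in> sets borel"
      have "(\<integral>\<omega>. indicator B (Z \<omega>) * (1 - \<beta> (Z \<omega>) * g) \<partial>M)
          = (\<integral>\<omega>. indicator B (Z \<omega>) - indicator B (Z \<omega>) * \<beta> (Z \<omega>) * g \<partial>M)"
        by (simp add: algebra_simps)
      also have "\<dots> = (\<integral>\<omega>. indicator B (Z \<omega>) \<partial>M) - (\<integral>\<omega>. indicator B (Z \<omega>) * \<beta> (Z \<omega>) \<partial>M) * g"
        using B_meas(2)[OF B] ind_int[OF \<beta>_int B] by simp
      finally show "(\<integral>\<omega>. indicator B (Z \<omega>) * ?p 0 \<omega> \<partial>M) = (\<integral>\<omega>. indicator B (Z \<omega>) * (1 - \<beta> (Z \<omega>) * g) \<partial>M)"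
        using arm0[OF B_meas[OF B] one] by (simp add: g_def prob_space)
    qed (use \<beta>_int p_int in simp_all)
    with pos_Z[of 0] show ?thesis by (auto simp: cond_prob_given_def)
  qed

  \<comment> \<open>The mean of \<open>?p 1 \<omega> * Y \<omega>\<close> given \<open>Z\<close> is
    computed twice, from \<open>\<mu> 1\<close> and, by the exclusion restriction, from
    \<open>m 1\<close>. Both results contain the positive factor
    \<open>\<beta> (Z \<omega>)\<close>, which cancels and leaves a constant.\<close>
  have \<mu>1: "AE \<omega> in M. \<mu> 1 (Z \<omega>) = h 1 / g"
  proof -
    have "AE \<omega> in M. cond_exp_given M (\<lambda>\<omega>. ?p 1 \<omega> * Y \<omega>) Z borel \<omega> = \<mu> 1 (Z \<omega>) * \<beta> (Z \<omega>) * g"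
    proof (rule cond_exp_given_eqI[OF prob Z_rv])
      fix B :: "real set" assume B: "B \<in> sets borel"
      have "(\<integral>\<omega>. indicator B (Z \<omega>) * (\<mu> 1 (Z \<omega>) * \<beta> (Z \<omega>) * g) \<partial>M)
          = (\<integral>\<omega>. indicator B (Z \<omega>) * \<mu> 1 (Z \<omega>) * \<beta> (Z \<omega>) \<partial>M) * g"
        by (simp flip: mult.assoc)
      also have "\<dots> = (\<integral>\<omega>. indicator B (Z \<omega>) * (?p 1 \<omega> * \<mu> 1 (Z \<omega>)) \<partial>M)"
        using arm1[OF B\<mu>[OF B, of 1] one] by (simp add: g_def mult_ac)
      finally show "(\<integral>\<omega>. indicator B (Z \<omega>) * (?p 1 \<omega> * Y \<omega>) \<partial>M)
          = (\<integral>\<omega>. indicator B (Z \<omega>) * (\<mu> 1 (Z \<omega>) * \<beta> (Z \<omega>) * g) \<partial>M)"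
        using \<mu>_reg(3)[of 1, OF _ B] by simp
    qed (use pY_int \<mu>\<beta>_int in simp_all)
    moreover have "AE \<omega> in M. cond_exp_given M (\<lambda>\<omega>. ?p 1 \<omega> * Y \<omega>) Z borel \<omega> = \<beta> (Z \<omega>) * h 1"
    proof (rule cond_exp_given_eqI[OF prob Z_rv])
      fix B :: "real set" assume B: "B \<in> sets borel"
      show "(\<integral>\<omega>. indicator B (Z \<omega>) * (?p 1 \<omega> * Y \<omega>) \<partial>M)
          = (\<integral>\<omega>. indicator B (Z \<omega>) * (\<beta> (Z \<omega>) * h 1) \<partial>M)"
        using arm1[OF B_meas[OF B] m_reg(1)[of 1] m_int[of 1]] Y_arm_m[OF B, of 1]
        by (simp add: h_def flip: mult.assoc)
    qed (use pY_int \<beta>_int in simp_all)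
    ultimately show ?thesis using \<beta>Z_pos
      by eventually_elim (use g in \<open>auto simp: field_simps\<close>)
  qed
  \<comment> \<open>The same double computation on the arm 0, where dependence on \<open>Z\<close>
    survives. The identity is kept undivided so that it can be integrated as it stands.\<close>
  have \<mu>0: "AE \<omega> in M. \<mu> 0 (Z \<omega>) - \<mu> 0 (Z \<omega>) * \<beta> (Z \<omega>) * g = e 0 - \<beta> (Z \<omega>) * h 0"
  proof -
    have "AE \<omega> in M. cond_exp_given M (\<lambda>\<omega>. ?p 0 \<omega> * Y \<omega>) Z borel \<omega>
        = \<mu> 0 (Z \<omega>) - \<mu> 0 (Z \<omega>) * \<beta> (Z \<omega>) * g"
    proof (rule cond_exp_given_eqI[OF prob Z_rv])
      fix B :: "real set" assume B: "B \<in> sets borel"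
      have "(\<integral>\<omega>. indicator B (Z \<omega>) * (\<mu> 0 (Z \<omega>) - \<mu> 0 (Z \<omega>) * \<beta> (Z \<omega>) * g) \<partial>M)
          = (\<integral>\<omega>. indicator B (Z \<omega>) * \<mu> 0 (Z \<omega>) - indicator B (Z \<omega>) * (\<mu> 0 (Z \<omega>) * \<beta> (Z \<omega>)) * g \<partial>M)"
        by (simp add: algebra_simps)
      also have "\<dots> = (\<integral>\<omega>. indicator B (Z \<omega>) * \<mu> 0 (Z \<omega>) \<partial>M)
          - (\<integral>\<omega>. indicator B (Z \<omega>) * (\<mu> 0 (Z \<omega>) * \<beta> (Z \<omega>)) \<partial>M) * g"
        using B\<mu>(2)[OF B, of 0] ind_int[OF \<mu>\<beta>_int[of 0] B] by simp
      finally show "(\<integral>\<omega>. indicator B (Z \<omega>) * (?p 0 \<omega> * Y \<omega>) \<partial>M)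
          = (\<integral>\<omega>. indicator B (Z \<omega>) * (\<mu> 0 (Z \<omega>) - \<mu> 0 (Z \<omega>) * \<beta> (Z \<omega>) * g) \<partial>M)"
        using arm0[OF B\<mu>[OF B, of 0] one] \<mu>_reg(3)[of 0, OF _ B] by (simp add: g_def prob_space mult_ac)
    qed (use pY_int \<mu>\<beta>_int \<mu>Z_int in simp_all)
    moreover have "AE \<omega> in M. cond_exp_given M (\<lambda>\<omega>. ?p 0 \<omega> * Y \<omega>) Z borel \<omega> = e 0 - \<beta> (Z \<omega>) * h 0"
    proof (rule cond_exp_given_eqI[OF prob Z_rv])
      fix B :: "real set" assume B: "B \<in> sets borel"
      have "(\<integral>\<omega>. indicator B (Z \<omega>) * (e 0 - \<beta> (Z \<omega>) * h 0) \<partial>M)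
          = (\<integral>\<omega>. indicator B (Z \<omega>) * e 0 - indicator B (Z \<omega>) * \<beta> (Z \<omega>) * h 0 \<partial>M)"
        by (simp add: algebra_simps)
      also have "\<dots> = (\<integral>\<omega>. indicator B (Z \<omega>) \<partial>M) * e 0 - (\<integral>\<omega>. indicator B (Z \<omega>) * \<beta> (Z \<omega>) \<partial>M) * h 0"
        using B_meas(2)[OF B] ind_int[OF \<beta>_int B] by simp
      finally show "(\<integral>\<omega>. indicator B (Z \<omega>) * (?p 0 \<omega> * Y \<omega>) \<partial>M)
          = (\<integral>\<omega>. indicator B (Z \<omega>) * (e 0 - \<beta> (Z \<omega>) * h 0) \<partial>M)"
        using arm0[OF B_meas[OF B] m_reg(1)[of 0] m_int[of 0]] Y_arm_m[OF B, of 0]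
        by (simp add: h_def e_def)
    qed (use pY_int \<beta>_int in simp_all)
    ultimately show ?thesis by eventually_elim simp
  qed

  \<comment> \<open>Covariance of the untreated regression with the propensity\<close>
  \<comment> \<open>Both sides are the integral of \<open>Y\<close> over the arm 0, once through
    \<open>\<mu> 0\<close> and once through \<open>m 0\<close>.\<close>
  have nk: "n - k * g = e 0 - b * h 0"
  proof -
    have "n - k * g = (\<integral>\<omega>. \<mu> 0 (Z \<omega>) - \<mu> 0 (Z \<omega>) * \<beta> (Z \<omega>) * g \<partial>M)"
      using \<mu>Z_int[of 0] \<mu>\<beta>_int[of 0] by (simp add: n_def k_def)
    also have "\<dots> = (\<integral>\<omega>. e 0 - \<beta> (Z \<omega>) * h 0 \<partial>M)"
      by (rule integral_cong_AE[OF _ _ \<mu>0]) simp_all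
    also have "\<dots> = e 0 - b * h 0" using \<beta>_int by (simp add: b_def prob_space)
    finally show ?thesis .
  qed

  \<comment> \<open>By \<open>\<mu>0\<close>, \<open>\<mu> 0 (Z \<omega>)\<close> is a fractional
    linear function of \<open>\<beta> (Z \<omega>)\<close>, non-increasing since
    \<open>e 0 * g \<le> h 0\<close>; the minus sign makes the pair comonotone.\<close>
  have cov_Z: "k \<le> n * b"
  proof -
    define S where "S = {\<omega>. \<mu> 0 (Z \<omega>) - \<mu> 0 (Z \<omega>) * \<beta> (Z \<omega>) * g = e 0 - \<beta> (Z \<omega>) * h 0
        \<and> 0 < 1 - \<beta> (Z \<omega>) * g}"
    have "AE \<omega> in M. \<omega> \<in> S" using \<mu>0 \<beta>Z_less by eventually_elim (simp add: S_def)
    moreover have "0 \<le> (- \<mu> 0 (Z x) - - \<mu> 0 (Z y)) * (\<beta> (Z x) - \<beta> (Z y))"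
      if "x \<in> S" "y \<in> S" for x y
    proof -
      \<comment> \<open>The two denominators. After multiplication by \<open>c * d\<close> the
        difference of the regressions is \<open>\<beta> (Z x) - \<beta> (Z y)\<close> times the
        nonnegative constant \<open>h 0 - e 0 * g\<close>.\<close>
      define c d where "c = 1 - \<beta> (Z x) * g" and "d = 1 - \<beta> (Z y) * g"
      have cd: "0 < c" "0 < d" using that by (auto simp: c_def d_def S_def)
      have "\<mu> 0 (Z x) * c = e 0 - \<beta> (Z x) * h 0" "\<mu> 0 (Z y) * d = e 0 - \<beta> (Z y) * h 0"
        using that by (auto simp: c_def d_def S_def algebra_simps)
      note eqs = this
      have "(\<mu> 0 (Z y) - \<mu> 0 (Z x)) * (c * d) = (\<mu> 0 (Z y) * d) * c - (\<mu> 0 (Z x) * c) * d"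
        by (simp add: algebra_simps)
      also have "\<dots> = (e 0 - \<beta> (Z y) * h 0) * c - (e 0 - \<beta> (Z x) * h 0) * d"
        by (simp only: eqs)
      also have "\<dots> = (\<beta> (Z x) - \<beta> (Z y)) * (h 0 - e 0 * g)"
        by (simp add: c_def d_def algebra_simps)
      finally have "(- \<mu> 0 (Z x) - - \<mu> 0 (Z y)) * (\<beta> (Z x) - \<beta> (Z y)) * (c * d)
          = (\<beta> (Z x) - \<beta> (Z y))\<^sup>2 * (h 0 - e 0 * g)"
        by (simp add: power2_eq_square mult_ac)
      also have "\<dots> \<ge> 0" using cov_U[of 0] by simp
      finally show ?thesis using mult_pos_pos[OF cd] by (metis zero_le_mult_iff not_le)
    qed
    moreover have "integrable M (\<lambda>\<omega>. - \<mu> 0 (Z \<omega>))" "integrable M (\<lambda>\<omega>. - \<mu> 0 (Z \<omega>) * \<beta> (Z \<omega>))"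
      using \<mu>Z_int[of 0] \<mu>\<beta>_int[of 0] by simp_all
    ultimately have "(\<integral>\<omega>. - \<mu> 0 (Z \<omega>) \<partial>M) * b \<le> (\<integral>\<omega>. - \<mu> 0 (Z \<omega>) * \<beta> (Z \<omega>) \<partial>M)"
      using integral_mult_ge_if_comonotone[OF _ \<beta>_int, folded b_def] by blast
    then show ?thesis by (simp add: n_def k_def)
  qed

  \<comment> \<open>Values of the estimators\<close>
  have mean: "mean_arm M A a X = (\<integral>\<omega>. ?p a \<omega> * X \<omega> \<partial>M) / measure M (arm M A a)"
    if "a \<in> {0, 1}" "X \<in> borel_measurable M" for a X
    unfolding mean_arm_def using that P_pos[OF that(1)]
    by (subst integral_uniform_measure) (auto simp: finite_measure_axioms arm_sets mult.commute)
  have Yp_meas: "Yp a \<in> borel_measurable M" if "a \<in> {0, 1}" for a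
    using Yp_int[OF that] by simp
  \<comment> \<open>On the treated arm \<open>b\<close> cancels, so \<open>m a\<close> at
    \<open>U\<close> is averaged with weight \<open>\<gamma> (U \<omega>) / g\<close>.\<close>
  have mean_Yp: "mean_arm M A 1 (Yp a) = h a / g"
    "mean_arm M A 0 (Yp a) = (e a - b * h a) / (1 - b * g)" if a: "a \<in> {0, 1}" for a
    using mean[OF _ Yp_meas[OF a]] Yp_m[OF a] p1_m[OF a] p0_m[OF a] P0 P1 b by simp_all
  have mean_Y: "mean_arm M A a Y = mean_arm M A a (Yp a)" if a: "a \<in> {0, 1}" for a
  proof -
    have "(\<integral>\<omega>. ?p a \<omega> * Y \<omega> \<partial>M) = (\<integral>\<omega>. ?p a \<omega> * Yp a \<omega> \<partial>M)"
      by (intro Bochner_Integration.integral_cong refl) (auto simp: Y_arm[OF _ a] split: split_indicator)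
    then show ?thesis using mean[OF a] Yp_meas[OF a] Y_int by simp
  qed
  have E_Yp: "(\<integral>\<omega>. Yp a \<omega> \<partial>M) = e a" if a: "a \<in> {0, 1}" for a
  proof -
    have "(\<integral>\<omega>. Yp a \<omega> \<partial>M) = (\<integral>\<omega>. ?p 0 \<omega> * Yp a \<omega> + ?p 1 \<omega> * Yp a \<omega> \<partial>M)"
      by (intro Bochner_Integration.integral_cong refl) (simp only: p0, simp add: algebra_simps)
    also have "\<dots> = (\<integral>\<omega>. ?p 0 \<omega> * Yp a \<omega> \<partial>M) + (\<integral>\<omega>. ?p 1 \<omega> * Yp a \<omega> \<partial>M)"
      using integrable_mult_indicator[OF arm_sets[of 0] Yp_int[OF a]]
        integrable_mult_indicator[OF arm_sets[of 1] Yp_int[OF a]] by simp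
    finally show ?thesis using Yp_m[OF a] p1_m[OF a] p0_m[OF a] by simp
  qed
  have distr_arm: "(\<integral>z. \<mu> c z \<partial>distr_arm M A a Z)
      = (\<integral>\<omega>. ?p a \<omega> * \<mu> c (Z \<omega>) \<partial>M) / measure M (arm M A a)"
    if a: "a \<in> {0, 1}" and c: "c \<in> {0, 1}" for a c
  proof -
    have "Z \<in> borel_measurable (uniform_measure M (arm M A a))" by simp
    then have "(\<integral>z. \<mu> c z \<partial>distr_arm M A a Z) = mean_arm M A a (\<lambda>\<omega>. \<mu> c (Z \<omega>))"
      unfolding distr_arm_def mean_arm_def by (rule integral_distr) (rule \<mu>_reg(1)[OF c])
    also have "\<dots> = (\<integral>\<omega>. ?p a \<omega> * \<mu> c (Z \<omega>) \<partial>M) / measure M (arm M A a)"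
      using \<mu>Z_int[OF c] by (intro mean a) simp
    finally show ?thesis .
  qed
  have adj1: "(\<integral>z. \<mu> 0 z \<partial>distr_arm M A 1 Z) = k / b"
  proof -
    have "(\<integral>\<omega>. ?p 1 \<omega> * \<mu> 0 (Z \<omega>) \<partial>M) = k * g"
      using arm1[OF \<mu>_reg(1)[of 0] \<mu>Z_int[of 0] one] by (simp add: k_def g_def mult.commute)
    then show ?thesis using distr_arm[of 1 0] P1 g by simp
  qed
  \<comment> \<open>Since \<open>\<mu> 1\<close> at \<open>Z\<close> is almost surely constant, its
    average does not depend on the distribution given to \<open>Z\<close>.\<close>
  have adj0: "(\<integral>z. \<mu> 1 z \<partial>distr_arm M A 0 Z) = h 1 / g"
  proof -
    have "(\<integral>\<omega>. ?p 0 \<omega> * \<mu> 1 (Z \<omega>) \<partial>M) = (\<integral>\<omega>. ?p 0 \<omega> * (h 1 / g) \<partial>M)"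
      using \<mu>1 by (intro integral_cong_AE) (auto elim!: eventually_mono)
    also have "\<dots> = measure M (arm M A 0) * (h 1 / g)" using arm_sets[of 0] by simp
    finally show ?thesis using distr_arm[of 0 1] P_pos[of 0] by simp
  qed
  have E_\<mu>0: "(\<integral>z. \<mu> 0 z \<partial>distr M borel Z) = n"
    by (simp add: integral_distr n_def)
  have E_\<mu>1: "(\<integral>z. \<mu> 1 z \<partial>distr M borel Z) = h 1 / g"
  proof -
    have "(\<integral>z. \<mu> 1 z \<partial>distr M borel Z) = (\<integral>\<omega>. \<mu> 1 (Z \<omega>) \<partial>M)"
      by (simp add: integral_distr)
    also have "\<dots> = (\<integral>\<omega>. h 1 / g \<partial>M)" by (rule integral_cong_AE[OF _ _ \<mu>1]) simp_all
    finally show ?thesis by (simp add: prob_space)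
  qed

  \<comment> \<open>Comparison of the values\<close>
  \<comment> \<open>Confounding raises the mean of \<open>Yp a\<close> above its population value
    \<open>e a\<close> on the arm 1 and, by \<open>le_e\<close>, lowers it on the arm 0.\<close>
  have e_le: "e a \<le> h a / g" if "a \<in> {0, 1}" for a
    using cov_U[OF that] g by (simp add: pos_le_divide_eq)
  have le_e: "(e a - b * h a) / (1 - b * g) \<le> e a" if "a \<in> {0, 1}" for a
    using mult_left_mono[OF cov_U[OF that], of b] b bg by (simp add: pos_divide_le_eq algebra_simps)
  \<comment> \<open>The averages of \<open>\<mu> 0\<close> at \<open>Z\<close> increase from the arm
    1 over the population to the arm 0, because \<open>\<mu> 0\<close> falls as the propensity
    rises; \<open>nk\<close> identifies the last one as the observed mean of \<open>Y\<close> on the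
    arm 0.\<close>
  have k_le: "k / b \<le> n" using cov_Z b by (simp add: pos_divide_le_eq)
  have n_le: "n \<le> (e 0 - b * h 0) / (1 - b * g)"
    using mult_left_mono[OF cov_Z, of g] g bg by (simp add: nk[symmetric] pos_le_divide_eq algebra_simps)
  note vals = mean_Y[of 0] mean_Y[of 1] mean_Yp[of 0] mean_Yp[of 1] E_Yp[of 0] E_Yp[of 1]
    adj0 adj1 E_\<mu>0 E_\<mu>1
  \<comment> \<open>By \<open>adj0\<close>, \<open>ACE0_adj\<close> equals \<open>ACE_unadj\<close>;
    the other two adjusted bounds follow from \<open>k_le\<close> and \<open>n_le\<close>, the
    bounds against the true effects from \<open>e_le\<close> and \<open>le_e\<close>.\<close>
  show ?thesis
    unfolding ACE1_adj_def ACE0_adj_def ACE_adj_def ACE_unadj_def ACE_true_arm_def ACE_true_def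
    using e_le[of 0] e_le[of 1] le_e[of 0] le_e[of 1] k_le n_le vals by simp
qed

end
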